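(* Suppose that the operators $\Pi^\ell$ ($\ell=0,1,2,3$) satisfy the commuting diagram and translation invariance assumption and that the shape function $S$ is admissible (see context). Then the evolution equations $$ \begin{cases} -\partial_t\boldsymbol E_h+\operatorname{curl}\boldsymbol B_h=\sum_{p=1}^Nq_p\,\Pi^2(\boldsymbol V_pS_{\boldsymbol X_p}),\\ \partial_t\boldsymbol B_h+\operatorname{curl}_w\boldsymbol E_h=0, \end{cases} \qquad \begin{cases} \frac{d\boldsymbol X_p}{dt}=\boldsymbol V_p,\\ \frac{d\boldsymbol V_p}{dt}=\frac{q_p}{m_p}\big(\boldsymbol E^S(\boldsymbol X_p)+\boldsymbol V_p\times\boldsymbol B^S(\boldsymbol X_p)\big), \end{cases}\quad p=1,\dots,N, $$ for $(\boldsymbol X_p(t),\boldsymbol V_p(t))_{p=1}^N\in(\mathbb R^3\times\mathbb R^3)^N$, $\boldsymbol E_h(t)\in V_h^2$, $\boldsymbol B_h(t)\in V_h^1$, preserve the discrete Hamiltonian $$\mathcal H_h=\sum_{p=1}^N\frac{m_p}{2}|\boldsymbol V_p|^2+\frac12\int_\Omega|\boldsymbol E_h|^2\,d\boldsymbol x+\frac12\int_\Omega|\boldsymbol B_h|^2\,d\boldsymbol x$$ (it is constant in time along solutions), as well as the discrete Gauss laws $$\operatorname{div}\boldsymbol E_h=\Pi^3\Big(\sum_{p=1}^Nq_pS_{\boldsymbol X_p}\Big),\qquad \operatorname{div}_w\boldsymbol B_h=0$$ (each of them holds at all times if it holds at the initial time).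
   Context: **Discrete spaces.** $\Omega$ is the spatial domain. $V_h^0,V_h^1,V_h^2,V_h^3$ are finite-dimensional spaces of square-integrable functions on $\Omega$ (scalar for $\ell=0,3$, $\mathbb R^3$-valued for $\ell=1,2$) with $\operatorname{grad}V_h^0\subset V_h^1$, $\operatorname{curl}V_h^1\subset V_h^2$, $\operatorname{div}V_h^2\subset V_h^3$. **Weak operators.** $\operatorname{curl}_w:V_h^2\to V_h^1$ and $\operatorname{div}_w:V_h^1\to V_h^0$ are the discrete adjoints defined by $\int_\Omega(\operatorname{curl}_w\boldsymbol F_h)\cdot\boldsymbol C_h=\int_\Omega\boldsymbol F_h\cdot\operatorname{curl}\boldsymbol C_h$ and $\int_\Omega(\operatorname{div}_w\boldsymbol C_h)\psi_h=-\int_\Omega\boldsymbol C_h\cdot\operatorname{grad}\psi_h$ for all $\boldsymbol F_h\in V_h^2$, $\boldsymbol C_h\in V_h^1$, $\psi_h\in V_h^0$. **Assumption on $\Pi^\ell$.** $V^0,V^1,V^2,V^3$ are infinite-dimensional linear function (or distribution) spaces (scalar for $\ell=0,3$, vector-valued for $\ell=1,2$) with $\operatorname{grad}V^0\subset V^1$, $\operatorname{curl}V^1\subset V^2$, $\operatorname{div}V^2\subset V^3$, each translation invariant ($G\in V^\ell\Rightarrow G(\cdot-\boldsymbol x)\in V^\ell$ for all $\boldsymbol x\in\mathbb R^3$). $\Pi^\ell:V^\ell\to V_h^\ell$ are linear projection operators such that $\Pi^1\operatorname{grad}G=\operatorname{grad}\Pi^0G$ for $G\in V^0$, $\Pi^2\operatorname{curl}\boldsymbol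 G=\operatorname{curl}\Pi^1\boldsymbol G$ for $\boldsymbol G\in V^1$, $\Pi^3\operatorname{div}\boldsymbol G=\operatorname{div}\Pi^2\boldsymbol G$ for $\boldsymbol G\in V^2$. **Admissible shape function.** A shape function $S$ is admissible if $S\in V^0$, $S\in V^3$, and $\boldsymbol eS\in V^1$, $\boldsymbol eS\in V^2$ for every $\boldsymbol e\in\mathbb R^3$. Write $S_{\boldsymbol y}(\boldsymbol x)=S(\boldsymbol x-\boldsymbol y)$. **Particles and coupling fields.** $N$ is the number of particles, $m_p\neq0$ and $q_p$ are real constants (particle masses and charges multiplied by their weights). With $(\boldsymbol e_1,\boldsymbol e_2,\boldsymbol e_3)$ the canonical basis of $\mathbb R^3$, $$\boldsymbol E^S(\boldsymbol X_p)=\sum_{\alpha=1}^3\boldsymbol e_\alpha\int_\Omega\boldsymbol E_h\cdot\Pi^2(\boldsymbol e_\alpha S_{\boldsymbol X_p})\,d\boldsymbol x,\qquad \boldsymbol B^S(\boldsymbol X_p)=\sum_{\alpha=1}^3\boldsymbol e_\alpha\int_\Omega\boldsymbol B_h\cdot\Pi^1(\boldsymbol e_\alpha S_{\boldsymbol X_p})\,d\boldsymbol x .$$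
   Formalization: Added assumption: V^3 is a sequentially complete locally convex space, continuously embedded in distributions, with strongly continuous translations, and Π^3 is continuous on it; for a merely linear Π^3 the Gauss law for E_h can fail. *)

theory Defs
  imports "HOL-Analysis.Analysis"
begin

section \<open>Test functions on three-dimensional space\<close>

definition partial :: "3 \<Rightarrow> (real^3 \<Rightarrow> real) \<Rightarrow> real^3 \<Rightarrow> real" where
  "partial i f = (\<lambda>x. frechet_derivative f (at x) (axis i 1))"

definition partials :: "3 list \<Rightarrow> (real^3 \<Rightarrow> real) \<Rightarrow> real^3 \<Rightarrow> real" where
  "partials is f = foldr partial is f"

definition smooth :: "(real^3 \<Rightarrow> real) \<Rightarrow> bool" where
  "smooth f \<longleftrightarrow> (\<forall>is. partials is f differentiable_on UNIV)"

lemma partials_Nil [simp]: "partials [] f = f"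
  and partials_Cons [simp]: "partials (i # is) f = partial i (partials is f)"
  and partials_snoc: "partials is (partial i f) = partials (is @ [i]) f"
  by (simp_all add: partials_def)

lemma smoothD: "smooth f \<Longrightarrow> partials is f differentiable at x"
  by (simp add: smooth_def differentiable_on_def)

lemma partial_lincomb:
  assumes "f differentiable at x" "g differentiable at x"
  shows "partial i (\<lambda>x. a * f x + b * g x) x = a * partial i f x + b * partial i g x"
proof -
  have "((\<lambda>x. a * f x + b * g x) has_derivative
      (\<lambda>h. a * frechet_derivative f (at x) h + b * frechet_derivative g (at x) h)) (at x)"
    using assms[unfolded frechet_derivative_works]
    by (auto intro!: derivative_eq_intros)
  from frechet_derivative_at[OF this, symmetric] show ?thesis
    by (simp add: partial_def)
qed

lemma partials_lincomb:
  assumes "smooth f" "smooth g"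
  shows "partials is (\<lambda>x. a * f x + b * g x) = (\<lambda>x. a * partials is f x + b * partials is g x)"
proof (induction "is")
  case (Cons i "is")
  show ?case
    by (simp only: partials_Cons Cons.IH, rule ext, rule partial_lincomb) (intro smoothD assms)+
qed simp

lemma smooth_lincomb:
  assumes "smooth f" "smooth g"
  shows "smooth (\<lambda>x. a * f x + b * g x)"
  unfolding smooth_def partials_lincomb[OF assms]
  unfolding differentiable_on_def
  by (auto intro!: differentiable_add differentiable_mult smoothD assms)

lemma smooth_partial: "smooth f \<Longrightarrow> smooth (partial i f)"
  by (simp add: smooth_def partials_snoc)

lemma partial_shift:
  assumes "f differentiable at (x + a)"
  shows "partial i (\<lambda>x. f (x + a)) x = partial i f (x + a)"
proof -
  have "(f has_derivative frechet_derivative f (at (x + a))) (at (x + a))"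
    using assms by (simp add: frechet_derivative_works)
  moreover have "((\<lambda>x. x + a) has_derivative (\<lambda>h. h)) (at x)"
    by (auto intro!: derivative_eq_intros)
  ultimately have "((\<lambda>x. f (x + a)) has_derivative frechet_derivative f (at (x + a))) (at x)"
    using has_derivative_compose[of "\<lambda>x. x + a" "\<lambda>h. h" x UNIV f] by simp
  from frechet_derivative_at[OF this, symmetric] show ?thesis
    by (simp add: partial_def)
qed

lemma partials_shift:
  assumes "smooth f"
  shows "partials is (\<lambda>x. f (x + a)) = (\<lambda>x. partials is f (x + a))"
proof (induction "is")
  case (Cons i "is")
  show ?case
    by (simp only: partials_Cons Cons.IH, rule ext, rule partial_shift) (intro smoothD assms)
qed simp

lemma smooth_shift:
  assumes "smooth f"
  shows "smooth (\<lambda>x. f (x + a))"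
  unfolding smooth_def partials_shift[OF assms] differentiable_on_def
proof clarify
  fix "is" x
  show "(\<lambda>x. partials is f (x + a)) differentiable at x within UNIV"
    by (rule differentiable_compose[OF smoothD[OF assms]]) simp
qed

lemma partials_zero [simp]: "partials is (\<lambda>x. 0) = (\<lambda>x. 0)"
  by (induction "is") (auto simp: partial_def)

lemma smooth_zero [simp]: "smooth (\<lambda>x. 0)"
  by (auto simp: smooth_def)

definition supp :: "('a::topological_space \<Rightarrow> 'b::zero) \<Rightarrow> 'a set" where
  "supp f = closure {x. f x \<noteq> 0}"

lemma supp_subset_iff:
  assumes "closed K"
  shows "supp f \<subseteq> K \<longleftrightarrow> (\<forall>x. x \<notin> K \<longrightarrow> f x = 0)"
proof
  assume "supp f \<subseteq> K"
  then show "\<forall>x. x \<notin> K \<longrightarrow> f x = 0"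
    using closure_subset[of "{x. f x \<noteq> 0}"] unfolding supp_def by blast
next
  assume "\<forall>x. x \<notin> K \<longrightarrow> f x = 0"
  with assms show "supp f \<subseteq> K"
    unfolding supp_def by (intro closure_minimal) auto
qed

lemma compact_suppI:
  fixes K :: "'a::t2_space set"
  assumes "compact K" "\<And>x. x \<notin> K \<Longrightarrow> f x = 0"
  shows "compact (supp f)"
proof -
  have "supp f \<subseteq> K"
    using assms by (simp add: supp_subset_iff compact_imp_closed)
  moreover have "closed (supp f)"
    by (simp add: supp_def)
  ultimately show ?thesis
    using compact_Int_closed[OF assms(1), of "supp f"] by (simp add: Int_absorb1)
qed

lemma not_in_supp: "x \<notin> supp f \<Longrightarrow> f x = 0"
  using closure_subset[of "{x. f x \<noteq> 0}"] unfolding supp_def by blast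

lemma partial_outside_supp:
  assumes "x \<notin> supp f"
  shows "partial i f x = 0"
proof -
  have "open (- supp f)"
    unfolding supp_def by (intro open_Compl closed_closure)
  have "(f has_derivative (\<lambda>h. 0)) (at x)"
  proof (rule has_derivative_transform_within_open[OF has_derivative_const])
    show "open (- supp f)" by fact
    show "x \<in> - supp f" using assms by simp
    show "\<And>x. x \<in> - supp f \<Longrightarrow> 0 = f x" by (simp add: not_in_supp)
  qed
  from frechet_derivative_at[OF this, symmetric] show ?thesis
    by (simp add: partial_def)
qed

typedef test_fun = "{f :: real^3 \<Rightarrow> real. smooth f \<and> compact (supp f)}"
  morphisms test_app Test_fun
  by (rule exI[of _ "\<lambda>x. 0"]) (simp add: supp_def)

setup_lifting type_definition_test_fun

lemma test_fun_lincomb: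
  fixes f g :: "real^3 \<Rightarrow> real"
  assumes "smooth f \<and> compact (supp f)" "smooth g \<and> compact (supp g)"
  shows "smooth (\<lambda>x. a * f x + b * g x) \<and> compact (supp (\<lambda>x. a * f x + b * g x))"
proof
  show "compact (supp (\<lambda>x. a * f x + b * g x))"
    by (rule compact_suppI[of "supp f \<union> supp g"]) (use assms in \<open>auto simp: not_in_supp\<close>)
qed (use assms in \<open>auto intro: smooth_lincomb\<close>)

instantiation test_fun :: real_vector
begin
lift_definition zero_test_fun :: test_fun is "\<lambda>x. 0"
  by (simp add: supp_def)
lift_definition plus_test_fun :: "test_fun \<Rightarrow> test_fun \<Rightarrow> test_fun" is "\<lambda>f g x. f x + g x"
  using test_fun_lincomb[of _ _ 1 1] by simp
lift_definition minus_test_fun :: "test_fun \<Rightarrow> test_fun \<Rightarrow> test_fun" is "\<lambda>f g x. f x - g x"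
  using test_fun_lincomb[of _ _ 1 "-1"] by simp
lift_definition uminus_test_fun :: "test_fun \<Rightarrow> test_fun" is "\<lambda>f x. - f x"
  using test_fun_lincomb[of _ "\<lambda>x. 0" "-1" 0] by (simp add: supp_def)
lift_definition scaleR_test_fun :: "real \<Rightarrow> test_fun \<Rightarrow> test_fun" is "\<lambda>c f x. c * f x"
  using test_fun_lincomb[of _ "\<lambda>x. 0" _ 0] by (simp add: supp_def)
instance
  by standard (transfer; auto simp: algebra_simps fun_eq_iff)+
end

lift_definition test_partial :: "3 \<Rightarrow> test_fun \<Rightarrow> test_fun" is partial
  by (auto intro: smooth_partial compact_suppI simp: partial_outside_supp)

lift_definition test_shift :: "real^3 \<Rightarrow> test_fun \<Rightarrow> test_fun" is "\<lambda>a f x. f (x + a)"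
proof -
  fix a :: "real^3" and f :: "real^3 \<Rightarrow> real"
  assume f: "smooth f \<and> compact (supp f)"
  have "compact ((\<lambda>x. x - a) ` supp f)"
    by (intro compact_continuous_image continuous_intros) (use f in auto)
  moreover have "f (x + a) = 0" if "x \<notin> (\<lambda>x. x - a) ` supp f" for x
    using that by (intro not_in_supp) (auto simp: image_iff)
  ultimately show "smooth (\<lambda>x. f (x + a)) \<and> compact (supp (\<lambda>x. f (x + a)))"
    using f by (auto intro: smooth_shift compact_suppI)
qed

definition test_seq_to_zero :: "(nat \<Rightarrow> test_fun) \<Rightarrow> bool" where
  "test_seq_to_zero \<phi> \<longleftrightarrow>
    (\<exists>K. compact K \<and> (\<forall>n. supp (test_app (\<phi> n)) \<subseteq> K)) \<and>
    (\<forall>is. uniform_limit UNIV (\<lambda>n. partials is (test_app (\<phi> n))) (\<lambda>x. 0) sequentially)"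

section \<open>Distributions on three-dimensional space\<close>

typedef distribution =
  "{T :: test_fun \<Rightarrow> real. linear T \<and> (\<forall>\<phi>. test_seq_to_zero \<phi> \<longrightarrow> (\<lambda>n. T (\<phi> n)) \<longlonglongrightarrow> 0)}"
  morphisms dist_app Distribution
  by (rule exI[of _ "\<lambda>x. 0"]) (simp add: linear_iff)

setup_lifting type_definition_distribution

instantiation distribution :: real_vector
begin
lift_definition zero_distribution :: distribution is "\<lambda>\<phi>. 0"
  by (simp add: linear_iff)
lift_definition plus_distribution :: "distribution \<Rightarrow> distribution \<Rightarrow> distribution"
  is "\<lambda>T U \<phi>. T \<phi> + U \<phi>"
  by (auto simp: linear_iff algebra_simps intro: tendsto_add_zero)
lift_definition minus_distribution :: "distribution \<Rightarrow> distribution \<Rightarrow> distribution"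
  is "\<lambda>T U \<phi>. T \<phi> - U \<phi>"
  by (auto simp: linear_iff algebra_simps intro: tendsto_eq_intros)
lift_definition uminus_distribution :: "distribution \<Rightarrow> distribution" is "\<lambda>T \<phi>. - T \<phi>"
  by (auto simp: linear_iff algebra_simps intro: tendsto_eq_intros)
lift_definition scaleR_distribution :: "real \<Rightarrow> distribution \<Rightarrow> distribution"
  is "\<lambda>c T \<phi>. c * T \<phi>"
  by (auto simp: linear_iff algebra_simps intro: tendsto_mult_right_zero)
instance
  by standard (transfer; auto simp: algebra_simps fun_eq_iff)+
end

lemma supp_partial: "supp (partial i f) \<subseteq> supp f"
  by (subst supp_subset_iff) (auto simp: partial_outside_supp, simp add: supp_def)

lemma test_seq_to_zero_partial:
  assumes "test_seq_to_zero \<phi>"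
  shows "test_seq_to_zero (\<lambda>n. test_partial i (\<phi> n))"
  using assms supp_partial unfolding test_seq_to_zero_def
  by (simp add: test_partial.rep_eq partials_snoc) (meson order_trans)

lemma test_seq_to_zero_shift:
  assumes "test_seq_to_zero \<phi>"
  shows "test_seq_to_zero (\<lambda>n. test_shift a (\<phi> n))"
proof -
  obtain K where K: "compact K" "\<And>n. supp (test_app (\<phi> n)) \<subseteq> K"
    and lim: "\<And>is. uniform_limit UNIV (\<lambda>n. partials is (test_app (\<phi> n))) (\<lambda>x. 0) sequentially"
    using assms unfolding test_seq_to_zero_def by blast
  have c: "compact ((\<lambda>x. x - a) ` K)"
    by (intro compact_continuous_image continuous_intros K)
  have s: "supp (test_app (test_shift a (\<phi> n))) \<subseteq> (\<lambda>x. x - a) ` K" for n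
    using K(2)[of n] compact_imp_closed[OF c] compact_imp_closed[OF K(1)]
    by (subst supp_subset_iff) (auto simp: supp_subset_iff test_shift.rep_eq image_iff algebra_simps)
  have "uniform_limit UNIV (\<lambda>n. partials is (test_app (test_shift a (\<phi> n)))) (\<lambda>x. 0) sequentially" for "is"
  proof -
    have "partials is (test_app (test_shift a (\<phi> n))) = (\<lambda>x. partials is (test_app (\<phi> n)) (x + a))" for n
      using test_app[of "\<phi> n"] by (simp add: test_shift.rep_eq partials_shift)
    then show ?thesis
      using lim[of "is"] unfolding uniform_limit_iff by (fastforce elim: eventually_mono)
  qed
  with c s show ?thesis
    unfolding test_seq_to_zero_def by blast
qed

lemma linear_test_partial: "linear (test_partial i)"
  unfolding linear_iff
proof (intro conjI allI)
  fix x y :: test_fun and c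
  show "test_partial i (x + y) = test_partial i x + test_partial i y"
    by transfer (use partials_lincomb[of _ _ "[i]" 1 1 for i] in \<open>auto simp: fun_eq_iff\<close>)
  show "test_partial i (c *\<^sub>R x) = c *\<^sub>R test_partial i x"
    by transfer (use partials_lincomb[of _ "\<lambda>x. 0" "[i]" _ 0 for i] in \<open>auto simp: fun_eq_iff\<close>)
qed

lemma linear_test_shift: "linear (test_shift a)"
  unfolding linear_iff by (intro conjI allI; transfer; auto)

lift_definition dist_partial :: "3 \<Rightarrow> distribution \<Rightarrow> distribution"
  is "\<lambda>i T \<phi>. - T (test_partial i \<phi>)"
  using linear_test_partial
  by (auto simp: linear_iff intro!: tendsto_minus_cancel_left[THEN iffD1] test_seq_to_zero_partial)

text \<open>\<open>translate a T\<close> is \<open>T(x - a)\<close>, hence the shift by \<open>+ a\<close> on the test function.\<close>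

lift_definition translate :: "real^3 \<Rightarrow> distribution \<Rightarrow> distribution"
  is "\<lambda>a T \<phi>. T (test_shift a \<phi>)"
  using linear_test_shift
  by (auto simp: linear_iff intro!: test_seq_to_zero_shift)

definition translate_vec :: "real^3 \<Rightarrow> distribution^3 \<Rightarrow> distribution^3" where
  "translate_vec a G = (\<chi> i. translate a (G $ i))"

definition vec_times :: "real^3 \<Rightarrow> distribution \<Rightarrow> distribution^3" where
  "vec_times e S = (\<chi> i. e $ i *\<^sub>R S)"

definition grad :: "distribution \<Rightarrow> distribution^3" where
  "grad T = (\<chi> i. dist_partial i T)"

definition curl :: "distribution^3 \<Rightarrow> distribution^3" where
  "curl G = vector [dist_partial 2 (G $ 3) - dist_partial 3 (G $ 2),
                    dist_partial 3 (G $ 1) - dist_partial 1 (G $ 3),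
                    dist_partial 1 (G $ 2) - dist_partial 2 (G $ 1)]"

definition divergence :: "distribution^3 \<Rightarrow> distribution" where
  "divergence G = (\<Sum>i\<in>UNIV. dist_partial i (G $ i))"

section \<open>Square-integrable fields modulo equality almost everywhere\<close>

definition square_integrable :: "(real^3 \<Rightarrow> 'b::euclidean_space) \<Rightarrow> bool" where
  "square_integrable f \<longleftrightarrow>
    f \<in> borel_measurable lborel \<and> integrable lborel (\<lambda>x. (norm (f x))\<^sup>2)"

definition ae_eq :: "(real^3 \<Rightarrow> 'b::euclidean_space) \<Rightarrow> (real^3 \<Rightarrow> 'b) \<Rightarrow> bool" where
  "ae_eq f g \<longleftrightarrow>
    square_integrable f \<and> square_integrable g \<and> (AE x in lborel. f x = g x)"

lemma square_integrable_zero [simp]: "square_integrable (\<lambda>x. 0)"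
  by (simp add: square_integrable_def)

lemma square_integrable_scaleR:
  "square_integrable f \<Longrightarrow> square_integrable (\<lambda>x. c *\<^sub>R f x)"
  by (auto simp: square_integrable_def power_mult_distrib)

lemma square_integrable_add:
  assumes "square_integrable f" "square_integrable g"
  shows "square_integrable (\<lambda>x. f x + g x)"
  unfolding square_integrable_def
proof
  show m: "(\<lambda>x. f x + g x) \<in> borel_measurable lborel"
    using assms by (auto simp: square_integrable_def)
  have "integrable lborel (\<lambda>x. 2 * (norm (f x))\<^sup>2 + 2 * (norm (g x))\<^sup>2)"
    using assms by (auto simp: square_integrable_def)
  then show "integrable lborel (\<lambda>x. (norm (f x + g x))\<^sup>2)"
  proof (rule Bochner_Integration.integrable_bound)
    have "(norm (f x + g x))\<^sup>2 \<le> 2 * (norm (f x))\<^sup>2 + 2 * (norm (g x))\<^sup>2" for x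
    proof -
      have "(norm (f x + g x))\<^sup>2 \<le> (norm (f x) + norm (g x))\<^sup>2"
        by (intro power_mono norm_triangle_ineq) auto
      also have "\<dots> \<le> 2 * (norm (f x))\<^sup>2 + 2 * (norm (g x))\<^sup>2"
        using sum_squares_bound[of "norm (f x)" "norm (g x)"] by (simp add: power2_sum)
      finally show ?thesis .
    qed
    then show "AE x in lborel. norm ((norm (f x + g x))\<^sup>2) \<le>
        norm (2 * (norm (f x))\<^sup>2 + 2 * (norm (g x))\<^sup>2)"
      by auto
  qed (use m in measurable)
qed

lemma integrable_inner:
  assumes "square_integrable f" "square_integrable g"
  shows "integrable lborel (\<lambda>x. f x \<bullet> g x)"
proof -
  have "integrable lborel (\<lambda>x. (norm (f x))\<^sup>2 + (norm (g x))\<^sup>2)"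
    using assms by (auto simp: square_integrable_def)
  then show ?thesis
  proof (rule Bochner_Integration.integrable_bound)
    have "\<bar>f x \<bullet> g x\<bar> \<le> (norm (f x))\<^sup>2 + (norm (g x))\<^sup>2" for x
      using Cauchy_Schwarz_ineq2[of "f x" "g x"] sum_squares_bound[of "norm (f x)" "norm (g x)"]
        mult_nonneg_nonneg[OF norm_ge_zero norm_ge_zero, of "f x" "g x"]
      by linarith
    then show "AE x in lborel. norm (f x \<bullet> g x) \<le> norm ((norm (f x))\<^sup>2 + (norm (g x))\<^sup>2)"
      by auto
  qed (use assms in \<open>auto simp: square_integrable_def\<close>)
qed

quotient_type (overloaded) 'b L2 = "real^3 \<Rightarrow> 'b::euclidean_space" / partial: ae_eq
proof (rule part_equivpI)
  show "\<exists>f. ae_eq f f"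
    by (rule exI[of _ "\<lambda>x. 0"]) (simp add: ae_eq_def)
  show "symp ae_eq"
    by (auto simp: symp_def ae_eq_def)
  show "transp ae_eq"
    unfolding transp_def ae_eq_def by (auto elim: AE_mp)
qed

instantiation L2 :: (euclidean_space) real_inner
begin

lift_definition zero_L2 :: "'a L2" is "\<lambda>x. 0"
  by (simp add: ae_eq_def)

lift_definition plus_L2 :: "'a L2 \<Rightarrow> 'a L2 \<Rightarrow> 'a L2" is "\<lambda>f g x. f x + g x"
  by (auto simp: ae_eq_def intro: square_integrable_add)

lift_definition scaleR_L2 :: "real \<Rightarrow> 'a L2 \<Rightarrow> 'a L2" is "\<lambda>c f x. c *\<^sub>R f x"
  by (auto simp: ae_eq_def intro: square_integrable_scaleR)

definition uminus_L2 :: "'a L2 \<Rightarrow> 'a L2" where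
  "- f = (-1) *\<^sub>R (f :: 'a L2)"

definition minus_L2 :: "'a L2 \<Rightarrow> 'a L2 \<Rightarrow> 'a L2" where
  "f - g = f + - (g :: 'a L2)"

lift_definition inner_L2 :: "'a L2 \<Rightarrow> 'a L2 \<Rightarrow> real" is "\<lambda>f g. LINT x|lborel. f x \<bullet> g x"
  by (rule Bochner_Integration.integral_cong_AE) (auto simp: ae_eq_def square_integrable_def)

definition norm_L2 :: "'a L2 \<Rightarrow> real" where
  "norm f = sqrt (f \<bullet> (f :: 'a L2))"

definition dist_L2 :: "'a L2 \<Rightarrow> 'a L2 \<Rightarrow> real" where
  "dist f g = norm (f - g :: 'a L2)"

definition sgn_L2 :: "'a L2 \<Rightarrow> 'a L2" where
  "sgn f = inverse (norm f) *\<^sub>R (f :: 'a L2)"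

definition uniformity_L2 :: "('a L2 \<times> 'a L2) filter" where
  "uniformity_L2 = (INF e\<in>{0<..}. principal {(f, g). dist f g < e})"

definition open_L2 :: "'a L2 set \<Rightarrow> bool" where
  "open_L2 U \<longleftrightarrow> (\<forall>x\<in>U. eventually (\<lambda>(x', y). x' = x \<longrightarrow> y \<in> U) uniformity)"

instance
proof
  fix f g h :: "'a L2" and a b :: real
  show "f + g + h = f + (g + h)"
    by transfer (auto simp: ae_eq_def add.assoc intro: square_integrable_add)
  show "f + g = g + f"
    by transfer (auto simp: ae_eq_def add.commute intro: square_integrable_add)
  show "0 + f = f"
    by transfer (auto simp: ae_eq_def)
  show "- f + f = 0"
    unfolding uminus_L2_def
    by transfer (auto simp: ae_eq_def intro!: square_integrable_add square_integrable_scaleR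
        simp del: scaleR_minus_left scaleR_minus1_left, simp)
  show "f - g = f + - g"
    by (simp add: minus_L2_def)
  show "a *\<^sub>R (f + g) = a *\<^sub>R f + a *\<^sub>R g"
    by transfer (auto simp: ae_eq_def scaleR_right_distrib
        intro!: square_integrable_add square_integrable_scaleR)
  show "(a + b) *\<^sub>R f = a *\<^sub>R f + b *\<^sub>R f"
    by transfer (auto simp: ae_eq_def scaleR_left_distrib
        intro!: square_integrable_add square_integrable_scaleR)
  show "a *\<^sub>R b *\<^sub>R f = (a * b) *\<^sub>R f"
    by transfer (auto simp: ae_eq_def intro!: square_integrable_scaleR)
  show "1 *\<^sub>R f = f"
    by transfer (auto simp: ae_eq_def)
  show "dist f g = norm (f - g)"
    by (simp add: dist_L2_def)
  show "sgn f = inverse (norm f) *\<^sub>R f"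
    by (simp add: sgn_L2_def)
  show "norm f = sqrt (f \<bullet> f)"
    by (simp add: norm_L2_def)
  show "f \<bullet> g = g \<bullet> f"
    by transfer (simp add: inner_commute)
  show "(f + g) \<bullet> h = f \<bullet> h + g \<bullet> h"
    by transfer (auto simp: inner_add_left ae_eq_def
        intro!: Bochner_Integration.integral_add integrable_inner)
  show "(a *\<^sub>R f) \<bullet> g = a * (f \<bullet> g)"
    by transfer simp
  show "0 \<le> f \<bullet> f"
    by transfer simp
  show "(f \<bullet> f = 0) \<longleftrightarrow> (f = 0)"
  proof transfer
    fix f :: "real^3 \<Rightarrow> 'a"
    assume f: "ae_eq f f"
    then have "integrable lborel (\<lambda>x. f x \<bullet> f x)"
      by (auto simp: ae_eq_def intro: integrable_inner)
    then have "(LINT x|lborel. f x \<bullet> f x) = 0 \<longleftrightarrow> (AE x in lborel. f x \<bullet> f x = 0)"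
      by (intro integral_nonneg_eq_0_iff_AE) auto
    then show "(LINT x|lborel. f x \<bullet> f x) = 0 \<longleftrightarrow> ae_eq f (\<lambda>x. 0)"
      using f by (auto simp: ae_eq_def)
  qed
qed (simp_all add: uniformity_L2_def open_L2_def)

end

text \<open>\<open>L2_on \<Omega>\<close> is $L^2(\Omega)$, with fields extended by zero; on it \<open>f \<bullet> g\<close> is
  $\int_\Omega f \cdot g$.\<close>

lift_definition vanishes_outside :: "(real^3) set \<Rightarrow> 'b::euclidean_space L2 \<Rightarrow> bool"
  is "\<lambda>\<Omega> f. AE x in lborel. x \<notin> \<Omega> \<longrightarrow> f x = 0"
proof -
  fix \<Omega> and f g :: "real^3 \<Rightarrow> 'b"
  assume "ae_eq f g"
  then have "AE x in lborel. f x = g x"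
    by (simp add: ae_eq_def)
  then show "(AE x in lborel. x \<notin> \<Omega> \<longrightarrow> f x = 0) = (AE x in lborel. x \<notin> \<Omega> \<longrightarrow> g x = 0)"
    by (intro iffI; elim AE_mp) (auto elim!: AE_mp)
qed

definition L2_on :: "(real^3) set \<Rightarrow> 'b::euclidean_space L2 set" where
  "L2_on \<Omega> = {f. vanishes_outside \<Omega> f}"

lift_definition component :: "3 \<Rightarrow> (real^3) L2 \<Rightarrow> real L2" is "\<lambda>i f x. f x $ i"
proof -
  fix i :: 3 and f g :: "real^3 \<Rightarrow> real^3"
  have "square_integrable (\<lambda>x. f x $ i)" if f: "square_integrable f" for f :: "real^3 \<Rightarrow> real^3"
    unfolding square_integrable_def
  proof
    have "f \<in> borel_measurable lborel"
      using f by (simp add: square_integrable_def)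
    then show m: "(\<lambda>x. f x $ i) \<in> borel_measurable lborel"
      using borel_measurable_inner[of f lborel "\<lambda>x. axis i 1"] by (simp add: inner_axis)
    show "integrable lborel (\<lambda>x. (norm (f x $ i))\<^sup>2)"
    proof (rule Bochner_Integration.integrable_bound)
      show "integrable lborel (\<lambda>x. (norm (f x))\<^sup>2)"
        using f by (simp add: square_integrable_def)
      show "AE x in lborel. norm ((norm (f x $ i))\<^sup>2) \<le> norm ((norm (f x))\<^sup>2)"
        using component_le_norm_cart[of "f _" i] by (auto simp: abs_le_square_iff[symmetric])
    qed (use m in measurable)
  qed
  then show "ae_eq f g \<Longrightarrow> ae_eq (\<lambda>x. f x $ i) (\<lambda>x. g x $ i)"
    by (auto simp: ae_eq_def)
qed

lemma continuous_smooth: "smooth f \<Longrightarrow> continuous_on UNIV f"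
  using differentiable_imp_continuous_on[of f UNIV] by (simp add: smooth_def) (metis partials_Nil)

lemma square_integrable_test_app: "square_integrable (test_app \<phi>)"
proof -
  let ?f = "test_app \<phi>"
  have c: "continuous_on UNIV ?f" and K: "compact (supp ?f)"
    using test_app[of \<phi>] by (auto intro: continuous_smooth)
  have "integrable lborel (\<lambda>x. indicator (supp ?f) x *\<^sub>R (norm (?f x))\<^sup>2)"
    by (intro borel_integrable_compact K continuous_intros continuous_on_subset[OF c]) auto
  also have "(\<lambda>x. indicator (supp ?f) x *\<^sub>R (norm (?f x))\<^sup>2) = (\<lambda>x. (norm (?f x))\<^sup>2)"
    by (auto simp: fun_eq_iff indicator_def not_in_supp)
  finally show ?thesis
    using c by (auto simp: square_integrable_def borel_measurable_continuous_onI)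
qed

lift_definition L2_test_pairing :: "real L2 \<Rightarrow> test_fun \<Rightarrow> real"
  is "\<lambda>u \<phi>. LINT x|lborel. u x * test_app \<phi> x"
  by (rule ext, rule Bochner_Integration.integral_cong_AE)
     (use square_integrable_test_app in
       \<open>auto simp: ae_eq_def square_integrable_def intro!: borel_measurable_times\<close>)

lemma integrable_test_pairing:
  "square_integrable u \<Longrightarrow> integrable lborel (\<lambda>x. u x * test_app \<phi> x)"
  using integrable_inner[OF _ square_integrable_test_app, of u \<phi>] by simp

lift_definition regular_dist :: "real L2 \<Rightarrow> distribution" is L2_test_pairing
proof safe
  fix u
  show "linear (L2_test_pairing u)"
    unfolding linear_iff
  proof (intro conjI allI)
    fix \<phi> \<psi> :: test_fun and c
    show "L2_test_pairing u (\<phi> + \<psi>) = L2_test_pairing u \<phi> + L2_test_pairing u \<psi>"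
      by transfer (auto simp: plus_test_fun.rep_eq algebra_simps ae_eq_def
          intro!: Bochner_Integration.integral_add integrable_test_pairing)
    show "L2_test_pairing u (c *\<^sub>R \<phi>) = c *\<^sub>R L2_test_pairing u \<phi>"
      by transfer (simp add: scaleR_test_fun.rep_eq algebra_simps)
  qed
next
  fix u \<phi>
  assume "test_seq_to_zero \<phi>"
  then obtain K where K: "compact K" "\<And>n. supp (test_app (\<phi> n)) \<subseteq> K"
    and lim: "\<And>is. uniform_limit UNIV (\<lambda>n. partials is (test_app (\<phi> n))) (\<lambda>x. 0) sequentially"
    unfolding test_seq_to_zero_def by blast
  have unif: "uniform_limit UNIV (\<lambda>n. test_app (\<phi> n)) (\<lambda>x. 0) sequentially"
    using lim[of "[]"] by simp
  have ptw: "(\<lambda>n. test_app (\<phi> n) x) \<longlonglongrightarrow> 0" for x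
    using tendsto_uniform_limitI[OF unif, of x] by simp
  obtain N where N: "\<And>n x. n \<ge> N \<Longrightarrow> \<bar>test_app (\<phi> n) x\<bar> < 1"
    using unif[unfolded uniform_limit_sequentially_iff, rule_format, of 1] by auto
  define k :: "real^3 \<Rightarrow> real" where "k = indicator K"
  have Kb: "K \<in> sets borel" "emeasure lborel K < \<infinity>"
    using K(1) emeasure_bounded_finite[OF compact_imp_bounded, of K]
    by (auto intro: borel_compact simp: less_top)
  have k: "square_integrable k"
    unfolding square_integrable_def k_def
  proof
    have "(\<lambda>x. (norm (indicator K x :: real))\<^sup>2) = (indicator K :: real^3 \<Rightarrow> real)"
      by (auto simp: indicator_def)
    then show "integrable lborel (\<lambda>x. (norm (indicator K x :: real))\<^sup>2)"
      using Kb by simp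
  qed (use Kb in simp)
  have "(\<lambda>n. LINT x|lborel. f x * test_app (\<phi> (n + N)) x) \<longlonglongrightarrow> integral\<^sup>L (lborel :: (real^3) measure) (\<lambda>x. 0)"
    if f: "square_integrable f" for f :: "real^3 \<Rightarrow> real"
  proof (rule integral_dominated_convergence[where w = "\<lambda>x. \<bar>f x * k x\<bar>"])
    have "integrable lborel (\<lambda>x. f x * k x)"
      using integrable_inner[OF f k] by simp
    then show "integrable lborel (\<lambda>x. \<bar>f x * k x\<bar>)"
      by (rule integrable_abs)
    show "AE x in lborel. (\<lambda>n. f x * test_app (\<phi> (n + N)) x) \<longlonglongrightarrow> 0"
      by (intro AE_I2 tendsto_mult_right_zero LIMSEQ_ignore_initial_segment ptw)
    show "AE x in lborel. norm (f x * test_app (\<phi> (n + N)) x) \<le> \<bar>f x * k x\<bar>" for n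
    proof (rule AE_I2)
      fix x
      have "\<bar>test_app (\<phi> (n + N)) x\<bar> \<le> \<bar>k x\<bar>"
      proof (cases "x \<in> K")
        case True
        then show ?thesis
          using N[of "n + N" x] by (simp add: k_def)
      next
        case False
        then have "test_app (\<phi> (n + N)) x = 0"
          using K(2)[of "n + N"] by (auto intro: not_in_supp)
        then show ?thesis
          by simp
      qed
      then show "norm (f x * test_app (\<phi> (n + N)) x) \<le> \<bar>f x * k x\<bar>"
        by (simp add: abs_mult mult_left_mono)
    qed
  qed (use f square_integrable_test_app in
      \<open>auto simp: square_integrable_def intro!: borel_measurable_times\<close>)
  then have "(\<lambda>n. L2_test_pairing u (\<phi> (n + N))) \<longlonglongrightarrow> 0"
    by transfer (simp add: ae_eq_def)
  then show "(\<lambda>n. L2_test_pairing u (\<phi> n)) \<longlonglongrightarrow> 0"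
    by (rule LIMSEQ_offset)
qed

section \<open>Weak derivatives of square-integrable fields on an open set\<close>

text \<open>Two distributions on $\mathbb{R}^3$ agree on \<open>\<Omega>\<close> if they agree on all test functions
  supported in \<open>\<Omega>\<close>. The derivatives of a field on \<open>\<Omega>\<close> are taken in the sense of distributions
  on \<open>\<Omega>\<close>, so that jumps of the extension by zero across the boundary do not enter. For open \<open>\<Omega>\<close>
  they are unique in \<open>L2_on \<Omega>\<close> when they exist.\<close>

definition dist_eq_on :: "(real^3) set \<Rightarrow> distribution \<Rightarrow> distribution \<Rightarrow> bool" where
  "dist_eq_on \<Omega> T U \<longleftrightarrow> (\<forall>\<phi>. supp (test_app \<phi>) \<subseteq> \<Omega> \<longrightarrow> dist_app T \<phi> = dist_app U \<phi>)"

definition dist_vec_eq_on :: "(real^3) set \<Rightarrow> distribution^3 \<Rightarrow> distribution^3 \<Rightarrow> bool" where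
  "dist_vec_eq_on \<Omega> G H \<longleftrightarrow> (\<forall>i. dist_eq_on \<Omega> (G $ i) (H $ i))"

definition regular_dist_vec :: "(real^3) L2 \<Rightarrow> distribution^3" where
  "regular_dist_vec F = (\<chi> i. regular_dist (component i F))"

definition has_grad_on :: "(real^3) set \<Rightarrow> real L2 \<Rightarrow> (real^3) L2 \<Rightarrow> bool" where
  "has_grad_on \<Omega> u g \<longleftrightarrow>
    g \<in> L2_on \<Omega> \<and> dist_vec_eq_on \<Omega> (grad (regular_dist u)) (regular_dist_vec g)"

definition has_curl_on :: "(real^3) set \<Rightarrow> (real^3) L2 \<Rightarrow> (real^3) L2 \<Rightarrow> bool" where
  "has_curl_on \<Omega> F G \<longleftrightarrow>
    G \<in> L2_on \<Omega> \<and> dist_vec_eq_on \<Omega> (curl (regular_dist_vec F)) (regular_dist_vec G)"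

definition has_div_on :: "(real^3) set \<Rightarrow> (real^3) L2 \<Rightarrow> real L2 \<Rightarrow> bool" where
  "has_div_on \<Omega> F d \<longleftrightarrow>
    d \<in> L2_on \<Omega> \<and> dist_eq_on \<Omega> (divergence (regular_dist_vec F)) (regular_dist d)"

definition grad_on :: "(real^3) set \<Rightarrow> real L2 \<Rightarrow> (real^3) L2" where
  "grad_on \<Omega> u = (THE g. has_grad_on \<Omega> u g)"

definition curl_on :: "(real^3) set \<Rightarrow> (real^3) L2 \<Rightarrow> (real^3) L2" where
  "curl_on \<Omega> F = (THE G. has_curl_on \<Omega> F G)"

definition div_on :: "(real^3) set \<Rightarrow> (real^3) L2 \<Rightarrow> real L2" where
  "div_on \<Omega> F = (THE d. has_div_on \<Omega> F d)"

section \<open>Discrete spaces and weak operators\<close>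

definition finite_dimensional :: "'a::real_vector set \<Rightarrow> bool" where
  "finite_dimensional V \<longleftrightarrow> (\<exists>B. finite B \<and> V \<subseteq> span B)"

definition discrete_space :: "(real^3) set \<Rightarrow> 'b::euclidean_space L2 set \<Rightarrow> bool" where
  "discrete_space \<Omega> Vh \<longleftrightarrow> subspace Vh \<and> finite_dimensional Vh \<and> Vh \<subseteq> L2_on \<Omega>"

definition discrete_complex ::
  "(real^3) set \<Rightarrow> real L2 set \<Rightarrow> (real^3) L2 set \<Rightarrow> (real^3) L2 set \<Rightarrow> real L2 set \<Rightarrow> bool" where
  "discrete_complex \<Omega> Vh0 Vh1 Vh2 Vh3 \<longleftrightarrow>
    discrete_space \<Omega> Vh0 \<and> discrete_space \<Omega> Vh1 \<and>
    discrete_space \<Omega> Vh2 \<and> discrete_space \<Omega> Vh3 \<and>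
    (\<forall>u\<in>Vh0. \<exists>g\<in>Vh1. has_grad_on \<Omega> u g) \<and>
    (\<forall>F\<in>Vh1. \<exists>G\<in>Vh2. has_curl_on \<Omega> F G) \<and>
    (\<forall>F\<in>Vh2. \<exists>d\<in>Vh3. has_div_on \<Omega> F d)"

definition weak_curl :: "(real^3) set \<Rightarrow> (real^3) L2 set \<Rightarrow> (real^3) L2 \<Rightarrow> (real^3) L2" where
  "weak_curl \<Omega> Vh1 F = (THE G. G \<in> Vh1 \<and> (\<forall>C\<in>Vh1. G \<bullet> C = F \<bullet> curl_on \<Omega> C))"

definition weak_div :: "(real^3) set \<Rightarrow> real L2 set \<Rightarrow> (real^3) L2 \<Rightarrow> real L2" where
  "weak_div \<Omega> Vh0 C = (THE d. d \<in> Vh0 \<and> (\<forall>\<psi>\<in>Vh0. d \<bullet> \<psi> = - (C \<bullet> grad_on \<Omega> \<psi>)))"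

section \<open>Commuting projections\<close>

definition translation_invariant_complex ::
  "distribution set \<Rightarrow> (distribution^3) set \<Rightarrow> (distribution^3) set \<Rightarrow> distribution set \<Rightarrow> bool" where
  "translation_invariant_complex V0 V1 V2 V3 \<longleftrightarrow>
    subspace V0 \<and> subspace V1 \<and> subspace V2 \<and> subspace V3 \<and>
    \<not> finite_dimensional V0 \<and> \<not> finite_dimensional V1 \<and>
    \<not> finite_dimensional V2 \<and> \<not> finite_dimensional V3 \<and>
    grad ` V0 \<subseteq> V1 \<and> curl ` V1 \<subseteq> V2 \<and> divergence ` V2 \<subseteq> V3 \<and>
    (\<forall>a. translate a ` V0 \<subseteq> V0) \<and> (\<forall>a. translate_vec a ` V1 \<subseteq> V1) \<and>
    (\<forall>a. translate_vec a ` V2 \<subseteq> V2) \<and> (\<forall>a. translate a ` V3 \<subseteq> V3)"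

text \<open>Elements of the domain \<open>V\<close> live on $\mathbb{R}^3$ and those of the range \<open>Vh\<close> on \<open>\<Omega>\<close>, so
  idempotence is expressed by a relation \<open>restr G v\<close>, to be read as \<open>G\<close> restricted to \<open>\<Omega>\<close> is \<open>v\<close>:
  each discrete field comes from an element of \<open>V\<close> (for instance a periodic extension) that is
  mapped to it. If \<open>\<Omega>\<close> is the whole space, this says \<open>Vh \<subseteq> V\<close> and \<open>L v = v\<close> on \<open>Vh\<close>.\<close>

definition linear_projection ::
  "('g::real_vector \<Rightarrow> 'f::real_vector \<Rightarrow> bool) \<Rightarrow> 'g set \<Rightarrow> 'f set \<Rightarrow> ('g \<Rightarrow> 'f) \<Rightarrow> bool" where
  "linear_projection restr V Vh L \<longleftrightarrow>
    (\<forall>G\<in>V. L G \<in> Vh) \<and>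
    (\<forall>G\<in>V. \<forall>H\<in>V. L (G + H) = L G + L H) \<and>
    (\<forall>c. \<forall>G\<in>V. L (c *\<^sub>R G) = c *\<^sub>R L G) \<and>
    (\<forall>v\<in>Vh. \<exists>G\<in>V. restr G v \<and> L G = v)"

definition restricts_to :: "(real^3) set \<Rightarrow> distribution \<Rightarrow> real L2 \<Rightarrow> bool" where
  "restricts_to \<Omega> G v \<longleftrightarrow> dist_eq_on \<Omega> G (regular_dist v)"

definition restricts_to_vec :: "(real^3) set \<Rightarrow> distribution^3 \<Rightarrow> (real^3) L2 \<Rightarrow> bool" where
  "restricts_to_vec \<Omega> G v \<longleftrightarrow> dist_vec_eq_on \<Omega> G (regular_dist_vec v)"

definition commuting_diagram ::
  "(real^3) set \<Rightarrow> distribution set \<Rightarrow> (distribution^3) set \<Rightarrow> (distribution^3) set \<Rightarrow>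
   (distribution \<Rightarrow> real L2) \<Rightarrow> (distribution^3 \<Rightarrow> (real^3) L2) \<Rightarrow>
   (distribution^3 \<Rightarrow> (real^3) L2) \<Rightarrow> (distribution \<Rightarrow> real L2) \<Rightarrow> bool" where
  "commuting_diagram \<Omega> V0 V1 V2 \<Pi>0 \<Pi>1 \<Pi>2 \<Pi>3 \<longleftrightarrow>
    (\<forall>G\<in>V0. \<Pi>1 (grad G) = grad_on \<Omega> (\<Pi>0 G)) \<and>
    (\<forall>G\<in>V1. \<Pi>2 (curl G) = curl_on \<Omega> (\<Pi>1 G)) \<and>
    (\<forall>G\<in>V2. \<Pi>3 (divergence G) = div_on \<Omega> (\<Pi>2 G))"

text \<open>A linear operator with finite-dimensional range need not be continuous, and for
  discontinuous \<open>\<Pi>3\<close> the derivative of \<open>\<Pi>3 (translate (X t) S)\<close> in \<open>t\<close> may fail to exist or to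
  be \<open>\<Pi>3\<close> of the derivative. The notions below express that \<open>V\<close> is a function space in the sense of
  functional analysis (a sequentially complete locally convex space, with topology given by a
  set \<open>P\<close> of seminorms, embedded continuously in the distributions, on which translations are
  strongly continuous) and that \<open>L\<close> is continuous on it. For a Banach space, \<open>P\<close> consists of the
  norm.\<close>

definition seminorm_on :: "'a::real_vector set \<Rightarrow> ('a \<Rightarrow> real) \<Rightarrow> bool" where
  "seminorm_on V p \<longleftrightarrow>
    (\<forall>u\<in>V. 0 \<le> p u) \<and> (\<forall>u\<in>V. \<forall>v\<in>V. p (u + v) \<le> p u + p v) \<and>
    (\<forall>c. \<forall>u\<in>V. p (c *\<^sub>R u) = \<bar>c\<bar> * p u)"

definition seminorm_continuous ::
  "'a::real_vector set \<Rightarrow> ('a \<Rightarrow> real) set \<Rightarrow> ('a \<Rightarrow> 'b::real_normed_vector) \<Rightarrow> bool" where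
  "seminorm_continuous V P L \<longleftrightarrow>
    (\<exists>Q C. finite Q \<and> Q \<subseteq> P \<and> (\<forall>u\<in>V. norm (L u) \<le> C * (\<Sum>p\<in>Q. p u)))"

definition sequentially_complete :: "'a::real_vector set \<Rightarrow> ('a \<Rightarrow> real) set \<Rightarrow> bool" where
  "sequentially_complete V P \<longleftrightarrow>
    (\<forall>u. (\<forall>n::nat. u n \<in> V) \<longrightarrow>
      (\<forall>p\<in>P. \<forall>e>0. \<exists>M. \<forall>j\<ge>M. \<forall>k\<ge>M. p (u j - u k) < e) \<longrightarrow>
      (\<exists>v\<in>V. \<forall>p\<in>P. (\<lambda>n. p (u n - v)) \<longlonglongrightarrow> 0))"

definition function_space :: "distribution set \<Rightarrow> (distribution \<Rightarrow> real) set \<Rightarrow> bool" where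
  "function_space V P \<longleftrightarrow>
    (\<forall>p\<in>P. seminorm_on V p) \<and>
    (\<forall>\<phi>. seminorm_continuous V P (\<lambda>u. dist_app u \<phi>)) \<and>
    sequentially_complete V P \<and>
    (\<forall>G\<in>V. \<forall>p\<in>P. ((\<lambda>a. p (translate a G - G)) \<longlongrightarrow> 0) (at 0))"

section \<open>The particle-field system\<close>

definition admissible_shape ::
  "distribution set \<Rightarrow> (distribution^3) set \<Rightarrow> (distribution^3) set \<Rightarrow> distribution set \<Rightarrow>
   distribution \<Rightarrow> bool" where
  "admissible_shape V0 V1 V2 V3 S \<longleftrightarrow>
    S \<in> V0 \<and> S \<in> V3 \<and> (\<forall>e. vec_times e S \<in> V1 \<and> vec_times e S \<in> V2)"

text \<open>Both coupling fields have this form, with \<open>\<Pi>2\<close> for the electric and \<open>\<Pi>1\<close> for the magnetic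
  field.\<close>

definition coupling_field ::
  "(distribution^3 \<Rightarrow> (real^3) L2) \<Rightarrow> distribution \<Rightarrow> (real^3) L2 \<Rightarrow> real^3 \<Rightarrow> real^3" where
  "coupling_field L S F x =
    (\<Sum>\<alpha>\<in>UNIV. (F \<bullet> L (vec_times (axis \<alpha> 1) (translate x S))) *\<^sub>R axis \<alpha> 1)"

definition pic_solution ::
  "(real^3) set \<Rightarrow> (real^3) L2 set \<Rightarrow> (real^3) L2 set \<Rightarrow>
   (distribution^3 \<Rightarrow> (real^3) L2) \<Rightarrow> (distribution^3 \<Rightarrow> (real^3) L2) \<Rightarrow> distribution \<Rightarrow>
   nat \<Rightarrow> (nat \<Rightarrow> real) \<Rightarrow> (nat \<Rightarrow> real) \<Rightarrow> real set \<Rightarrow>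
   (nat \<Rightarrow> real \<Rightarrow> real^3) \<Rightarrow> (nat \<Rightarrow> real \<Rightarrow> real^3) \<Rightarrow>
   (real \<Rightarrow> (real^3) L2) \<Rightarrow> (real \<Rightarrow> (real^3) L2) \<Rightarrow> bool" where
  "pic_solution \<Omega> Vh1 Vh2 \<Pi>1 \<Pi>2 S N m q I X V E B \<longleftrightarrow>
    (\<forall>t\<in>I. E t \<in> Vh2 \<and> B t \<in> Vh1 \<and>
      (\<exists>dE. (E has_vector_derivative dE) (at t within I) \<and>
        - dE + curl_on \<Omega> (B t) =
          (\<Sum>p=1..N. q p *\<^sub>R \<Pi>2 (vec_times (V p t) (translate (X p t) S)))) \<and>
      (\<exists>dB. (B has_vector_derivative dB) (at t within I) \<and>
        dB + weak_curl \<Omega> Vh1 (E t) = 0) \<and>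
      (\<forall>p\<in>{1..N}.
        (X p has_vector_derivative V p t) (at t within I) \<and>
        (V p has_vector_derivative
          (q p / m p) *\<^sub>R (coupling_field \<Pi>2 S (E t) (X p t) +
            cross3 (V p t) (coupling_field \<Pi>1 S (B t) (X p t)))) (at t within I)))"

definition discrete_hamiltonian ::
  "nat \<Rightarrow> (nat \<Rightarrow> real) \<Rightarrow> (nat \<Rightarrow> real^3) \<Rightarrow> (real^3) L2 \<Rightarrow> (real^3) L2 \<Rightarrow> real" where
  "discrete_hamiltonian N m V E B =
    (\<Sum>p=1..N. m p / 2 * (norm (V p))\<^sup>2) + (E \<bullet> E) / 2 + (B \<bullet> B) / 2"

end

(* By commutation of the operators Pi with curl and div and the adjointness of curl and weak curl,
   the time derivatives of the three quantities cancel term by term; the magnetic force drops out of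
   the energy balance because V x B is orthogonal to V, and the magnetic Gauss law is curl grad = 0
   in weak form. The analytic point is the charge balance: the derivative of Pi3 S_X must be
   -Pi3 div (V S_X), although the difference quotients of S are only controlled as distributions. On
   a segment, the increment of S_X is minus the integral of div (d S), as a distribution; strong
   continuity of translations and sequential completeness make the Riemann sums converge in V3, so
   that the continuous operator Pi3 can be applied to this integral, which yields the derivative.
   The differential operators on the discrete fields are defined by description. They are well
   defined by the fundamental lemma of the calculus of variations, for which the test functions
   prod_i exp(-1/(n (x_i - a_i))) exp(-1/(n (b_i - x_i))) increase to the indicator of a box. *)

theory Submission
  imports Defs "HOL-Real_Asymp.Real_Asymp"
begin

section \<open>Smooth functions and test functions\<close>

text \<open>Curl and divergence of discrete fields are total functions by description, known to be
  linear only where the derivatives exist. Finite dimension restores calculus in time: an orthogonal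
  expansion extends such an operator from a discrete space to a bounded linear map on all of
  \<open>L2\<close>, and it also gives the Riesz vectors behind \<open>weak_curl\<close>. The space
  \<open>V3\<close> is a set of distributions without a topology of its type, so convergence in it
  is treated one seminorm at a time, and uniform continuity is reduced to real functions such as p(f
  s - f t). Evaluation at a test function is a continuous operator on \<open>V3\<close> just as
  \<open>\<Pi>3\<close> is; this identifies the limit found by completeness, and the same lemmas
  serve both. The derivative of the projected charge is needed in the Frechet sense, because the
  particles move along curves. Uniformity in the direction d holds because div (d S) is a
  combination of only three distributions, the partial derivatives of S. Since \<open>smooth\<close>
  speaks of all iterated partial derivatives, smoothness is proved by exhibiting a class of
  functions stable under \<open>partial\<close>; hence the polynomial factor in
  \<open>flat_exp\<close>.\<close>

lemma smooth_has_derivative_line: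
  assumes "smooth f"
  shows "((\<lambda>s. f (x + s *\<^sub>R v)) has_real_derivative (\<Sum>i\<in>UNIV. v $ i * partial i f (x + s *\<^sub>R v))) (at s)"
proof -
  let ?D = "frechet_derivative f (at (x + s *\<^sub>R v))"
  have D: "(f has_derivative ?D) (at (x + s *\<^sub>R v))"
    using smoothD[OF assms, of "[]"] by (simp add: frechet_derivative_works)
  then interpret bounded_linear ?D by (rule has_derivative_bounded_linear)
  have "((\<lambda>s. x + s *\<^sub>R v) has_derivative (\<lambda>r. r *\<^sub>R v)) (at s)"
    by (auto intro!: derivative_eq_intros)
  from has_derivative_compose[OF this D]
  have "((\<lambda>s. f (x + s *\<^sub>R v)) has_derivative (\<lambda>r. ?D (r *\<^sub>R v))) (at s)" .
  moreover have "?D (r *\<^sub>R v) = (\<Sum>i\<in>UNIV. v $ i * partial i f (x + s *\<^sub>R v)) * r" for r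
  proof -
    have "?D v = ?D (\<Sum>i\<in>UNIV. v $ i *\<^sub>R axis i 1)"
      using basis_expansion[of v] by (simp add: scalar_mult_eq_scaleR)
    also have "\<dots> = (\<Sum>i\<in>UNIV. v $ i * partial i f (x + s *\<^sub>R v))"
      by (simp add: sum scaleR partial_def)
    finally show ?thesis by (simp add: scaleR)
  qed
  ultimately show ?thesis
    by (simp add: has_field_derivative_def)
qed

lemma smooth_has_derivative_axis:
  assumes "smooth f"
  shows "((\<lambda>s. f (x + s *\<^sub>R axis i 1)) has_real_derivative partial i f (x + s *\<^sub>R axis i 1)) (at s)"
  using smooth_has_derivative_line[OF assms, of x "axis i 1" s]
  by (simp add: axis_def if_distrib[of "\<lambda>a. a * _"] cong: if_cong)

text \<open>The mean value theorem is used twice: for the increment in direction j as a function of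
  the coordinate i, then for \<open>partial i f\<close> in direction j. The left side is symmetric
  in i and j while the order of differentiation on the right is not.\<close>

lemma second_difference:
  assumes "smooth f" "0 < h"
  shows "\<exists>s r. 0 < s \<and> s < h \<and> 0 < r \<and> r < h \<and>
    f (x + h *\<^sub>R axis i 1 + h *\<^sub>R axis j 1) - f (x + h *\<^sub>R axis i 1) - f (x + h *\<^sub>R axis j 1) + f x =
    h\<^sup>2 * partial j (partial i f) (x + s *\<^sub>R axis i 1 + r *\<^sub>R axis j 1)"
proof -
  let ?g = "\<lambda>s. f (x + h *\<^sub>R axis j 1 + s *\<^sub>R axis i 1) - f (x + s *\<^sub>R axis i 1)"
  have "\<exists>s>0. s < h \<and> ?g h - ?g 0 = (h - 0) *
      (partial i f (x + h *\<^sub>R axis j 1 + s *\<^sub>R axis i 1) - partial i f (x + s *\<^sub>R axis i 1))"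
    by (rule MVT2[OF \<open>0 < h\<close>]) (intro DERIV_diff smooth_has_derivative_axis assms)
  then obtain s where s: "0 < s" "s < h" "?g h - ?g 0 = h *
      (partial i f (x + h *\<^sub>R axis j 1 + s *\<^sub>R axis i 1) - partial i f (x + s *\<^sub>R axis i 1))"
    by auto
  let ?k = "\<lambda>r. partial i f ((x + s *\<^sub>R axis i 1) + r *\<^sub>R axis j 1)"
  have "\<exists>r>0. r < h \<and> ?k h - ?k 0 = (h - 0) * partial j (partial i f) ((x + s *\<^sub>R axis i 1) + r *\<^sub>R axis j 1)"
    by (rule MVT2[OF \<open>0 < h\<close>]) (intro smooth_has_derivative_axis smooth_partial assms)
  then obtain r where r: "0 < r" "r < h"
    "?k h - ?k 0 = h * partial j (partial i f) (x + s *\<^sub>R axis i 1 + r *\<^sub>R axis j 1)"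
    by auto
  have "?g h - ?g 0 = h * (?k h - ?k 0)"
    unfolding s(3) by (simp add: algebra_simps)
  also have "\<dots> = h\<^sup>2 * partial j (partial i f) (x + s *\<^sub>R axis i 1 + r *\<^sub>R axis j 1)"
    by (simp only: r(3)) (simp add: power2_eq_square)
  finally show ?thesis
    using s(1,2) r(1,2) by (intro exI[of _ s] exI[of _ r]) (simp add: algebra_simps)
qed

text \<open>Schwarz's theorem. By symmetry of the second difference the two mixed derivatives take
  equal values at two points near x, and both are continuous because a smooth function has smooth
  partial derivatives.\<close>

lemma partial_commute:
  assumes "smooth f"
  shows "partial i (partial j f) = partial j (partial i f)"
proof
  fix x
  let ?a = "partial j (partial i f)" and ?b = "partial i (partial j f)"
  have cont: "isCont ?a x" "isCont ?b x"
    using continuous_smooth smooth_partial assms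
    by (metis continuous_on_eq_continuous_at open_UNIV UNIV_I)+
  have bound: "dist (x + s *\<^sub>R axis k 1 + r *\<^sub>R axis l (1::real)) x < 2 * h" if "0 < s" "s < h" "0 < r" "r < h" for s r h k l
    using norm_triangle_ineq[of "s *\<^sub>R axis k (1::real)" "r *\<^sub>R axis l (1::real)"] that
    by (simp add: dist_norm norm_axis_1 add.assoc)
  have "\<bar>?a x - ?b x\<bar> < e" if "0 < e" for e
  proof -
    obtain d1 where d1: "d1 > 0" "\<And>y. dist y x < d1 \<Longrightarrow> dist (?a y) (?a x) < e/2"
      using cont(1)[unfolded continuous_at_eps_delta] \<open>0 < e\<close> by (meson half_gt_zero)
    obtain d2 where d2: "d2 > 0" "\<And>y. dist y x < d2 \<Longrightarrow> dist (?b y) (?b x) < e/2"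
      using cont(2)[unfolded continuous_at_eps_delta] \<open>0 < e\<close> by (meson half_gt_zero)
    \<comment> \<open>The points supplied by \<open>second_difference\<close> lie at distance less
      than 2h from x, hence the half.\<close>
    define h where "h = min d1 d2 / 2"
    have h: "0 < h" "2 * h \<le> d1" "2 * h \<le> d2" using d1 d2 by (auto simp: h_def)
    obtain s r where 1: "0 < s" "s < h" "0 < r" "r < h"
      "f (x + h *\<^sub>R axis i 1 + h *\<^sub>R axis j 1) - f (x + h *\<^sub>R axis i 1) - f (x + h *\<^sub>R axis j 1) + f x =
       h\<^sup>2 * ?a (x + s *\<^sub>R axis i 1 + r *\<^sub>R axis j 1)"
      using second_difference[OF assms h(1), of x i j] by blast
    obtain s' r' where 2: "0 < s'" "s' < h" "0 < r'" "r' < h"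
      "f (x + h *\<^sub>R axis j 1 + h *\<^sub>R axis i 1) - f (x + h *\<^sub>R axis j 1) - f (x + h *\<^sub>R axis i 1) + f x =
       h\<^sup>2 * ?b (x + s' *\<^sub>R axis j 1 + r' *\<^sub>R axis i 1)"
      using second_difference[OF assms h(1), of x j i] by blast
    have "h\<^sup>2 * ?a (x + s *\<^sub>R axis i 1 + r *\<^sub>R axis j 1) = h\<^sup>2 * ?b (x + s' *\<^sub>R axis j 1 + r' *\<^sub>R axis i 1)"
      unfolding 1(5)[symmetric] 2(5)[symmetric] by (simp add: algebra_simps)
    then have "?a (x + s *\<^sub>R axis i 1 + r *\<^sub>R axis j 1) = ?b (x + s' *\<^sub>R axis j 1 + r' *\<^sub>R axis i 1)"
      using h by simp
    moreover note d1(2)[OF less_le_trans[OF bound[OF 1(1-4)] h(2)], of i j, unfolded dist_real_def]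
      d2(2)[OF less_le_trans[OF bound[OF 2(1-4)] h(3)], of j i, unfolded dist_real_def]
    ultimately show ?thesis by linarith
  qed
  then show "?b x = ?a x" by (metis dense_eq0_I eq_iff_diff_eq_0 less_imp_le)
qed

lemma test_partial_commute: "test_partial i (test_partial j \<phi>) = test_partial j (test_partial i \<phi>)"
  by transfer (auto intro: partial_commute)

lemma test_partial_shift: "test_partial i (test_shift a \<phi>) = test_shift a (test_partial i \<phi>)"
  by transfer (use partials_shift[of _ "[i]" for i] in simp)

text \<open>A class stable under \<open>partial\<close> contains all iterated partial derivatives of
  its members, so a single differentiation within the class replaces an induction over lists of
  indices.\<close>

lemma smoothI_class:
  assumes "f \<in> C"
    and diff: "\<And>f x. f \<in> C \<Longrightarrow> f differentiable at x"
    and closed: "\<And>f i. f \<in> C \<Longrightarrow> partial i f \<in> C"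
  shows "smooth f"
proof -
  have "partials is f \<in> C" for "is"
    by (induction "is") (auto intro: assms)
  then show ?thesis by (auto simp: smooth_def differentiable_on_def intro: diff)
qed

text \<open>Products alone are not stable under \<open>partial\<close>, as the Leibniz rule yields a
  sum of two of them; closing under addition repairs this without a formula for higher
  derivatives.\<close>

inductive_set sums_of_products :: "(real^3 \<Rightarrow> real) set" where
  prod: "smooth f \<Longrightarrow> smooth g \<Longrightarrow> (\<lambda>x. f x * g x) \<in> sums_of_products"
| add: "f \<in> sums_of_products \<Longrightarrow> g \<in> sums_of_products \<Longrightarrow> (\<lambda>x. f x + g x) \<in> sums_of_products"

lemma partial_times:
  assumes "f differentiable at x" "g differentiable at x"
  shows "partial i (\<lambda>x. f x * g x) x = partial i f x * g x + f x * partial i g x"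
proof -
  have "((\<lambda>x. f x * g x) has_derivative
      (\<lambda>h. f x * frechet_derivative g (at x) h + frechet_derivative f (at x) h * g x)) (at x)"
    using assms[unfolded frechet_derivative_works] by (rule has_derivative_mult)
  from frechet_derivative_at[OF this, symmetric] show ?thesis
    by (simp add: partial_def)
qed

lemma smooth_times:
  assumes "smooth f" "smooth g"
  shows "smooth (\<lambda>x. f x * g x)"
proof (rule smoothI_class)
  show "(\<lambda>x. f x * g x) \<in> sums_of_products"
    using assms by (rule sums_of_products.prod)
  show diff: "h differentiable at x" if "h \<in> sums_of_products" for h x
    using that
    by induction (simp_all add: differentiable_mult smoothD[of _ "[]", simplified])
  show "partial i h \<in> sums_of_products" if "h \<in> sums_of_products" for i h
    using that
  proof induction
    case (prod f g)
    have "partial i (\<lambda>x. f x * g x) = (\<lambda>x. partial i f x * g x + f x * partial i g x)"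
      using prod by (intro ext partial_times) (auto intro: smoothD[of _ "[]", simplified])
    then show ?case
      using prod by (auto intro!: sums_of_products.intros smooth_partial)
  next
    case (add f g)
    then have "partial i (\<lambda>x. f x + g x) = (\<lambda>x. partial i f x + partial i g x)"
      using partial_lincomb[OF diff diff, of f g i 1 1] by (auto simp: fun_eq_iff)
    then show ?case
      using add by (auto intro: sums_of_products.intros)
  qed
qed

section \<open>The flat function exp(-1/t) and its derivatives\<close>

definition flat_exp :: "real poly \<Rightarrow> real \<Rightarrow> real" where
  "flat_exp p t = (if 0 < t then poly p (1 / t) * exp (- (1 / t)) else 0)"

text \<open>With s = 1/t the non-constant part becomes a polynomial in s times exp(-s), which decays
  as s tends to infinity.\<close>

lemma flat_exp_tendsto: "((\<lambda>t. poly p (1 / t) * exp (- (1 / t))) \<longlongrightarrow> 0) (at_right (0::real))"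
proof (induction p)
  case (pCons a p)
  have 1: "((\<lambda>t::real. a * exp (- (1 / t))) \<longlongrightarrow> 0) (at_right 0)"
    by (rule tendsto_mult_right_zero) real_asymp
  have *: "((\<lambda>t. poly p (1 / t) * (1 / t) * exp (- (1 / t))) \<longlongrightarrow> 0) (at_right (0::real))"
  proof -
    have "((\<lambda>s. poly p s * s * exp (- s)) \<longlongrightarrow> 0) at_top"
    proof -
      have "((\<lambda>s. poly q s * exp (- s)) \<longlongrightarrow> 0) at_top" for q :: "real poly"
      proof -
        have "((\<lambda>s. (\<Sum>i\<le>degree q. coeff q i * (s ^ i / exp s))) \<longlongrightarrow> 0) at_top"
          by (intro tendsto_null_sum tendsto_mult_right_zero tendsto_power_div_exp_0)
        then show ?thesis
          by (simp add: poly_altdef sum_distrib_right exp_minus divide_inverse mult.assoc)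
      qed
      from this[of "[:0, 1:] * p"] show ?thesis by (simp add: ac_simps)
    qed
    moreover have "filterlim (\<lambda>t::real. 1 / t) at_top (at_right 0)"
      by real_asymp
    ultimately show ?thesis by (rule filterlim_compose)
  qed
  from tendsto_add[OF 1 *] show ?case by (simp add: algebra_simps)
qed simp

text \<open>For t > 0, differentiating p(1/t) exp(-1/t) brings out the factor 1/t^2 and replaces p
  by p - p', which explains the new polynomial. At t = 0 the right difference quotient is again of
  the form p(1/t) (1/t) exp(-1/t), so it tends to 0, and the left one is 0.\<close>

lemma DERIV_flat_exp:
  "(flat_exp p has_real_derivative flat_exp ([:0, 0, 1:] * (p - pderiv p)) t) (at t)"
proof -
  let ?q = "[:0, 0, 1:] * (p - pderiv p)"
  consider "t > 0" | "t < 0" | "t = 0" by linarith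
  then show ?thesis
  proof cases
    case 1
    have "((\<lambda>t. poly p (1 / t) * exp (- (1 / t))) has_real_derivative flat_exp ?q t) (at t)"
      using 1 by (auto intro!: derivative_eq_intros DERIV_chain2[OF poly_DERIV] 
         simp: flat_exp_def field_simps power2_eq_square)
    then show ?thesis
      by (rule has_field_derivative_transform_within_open[of _ _ _ "{0<..}"]) (use 1 in \<open>auto simp: flat_exp_def\<close>)
  next
    case 2
    have "((\<lambda>t. 0) has_real_derivative flat_exp ?q t) (at t)"
      using 2 by (simp add: flat_exp_def)
    then show ?thesis
      by (rule has_field_derivative_transform_within_open[of _ _ _ "{..<0}"]) (use 2 in \<open>auto simp: flat_exp_def\<close>)
  next
    case 3
    have "((\<lambda>t. flat_exp p t / t) \<longlongrightarrow> 0) (at_right 0)"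
      by (rule tendsto_cong[THEN iffD1, OF _ flat_exp_tendsto[of "[:0,1:] * p"]])
         (auto simp: eventually_at_filter flat_exp_def intro!: always_eventually)
    moreover have "((\<lambda>t. flat_exp p t / t) \<longlongrightarrow> 0) (at_left 0)"
      by (rule tendsto_cong[THEN iffD1, OF _ tendsto_const])
         (auto simp: eventually_at_filter flat_exp_def intro!: always_eventually)
    ultimately have "((\<lambda>t. flat_exp p t / t) \<longlongrightarrow> 0) (at 0)"
      by (simp add: filterlim_at_split)
    then show ?thesis
      using 3 by (simp add: has_field_derivative_iff flat_exp_def)
  qed
qed

lemma smooth_flat_exp: "smooth (\<lambda>x. flat_exp p (\<alpha> * x $ i + \<beta>))"
proof (rule smoothI_class)
  let ?C = "range (\<lambda>p x. flat_exp p (\<alpha> * x $ i + \<beta>))"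
  have *: "((\<lambda>x. flat_exp p (\<alpha> * x $ i + \<beta>)) has_derivative
      (\<lambda>h. flat_exp ([:0, 0, 1:] * (p - pderiv p)) (\<alpha> * x $ i + \<beta>) * (\<alpha> * h $ i))) (at x)" for x p
    by (rule has_derivative_compose[OF _ DERIV_flat_exp[unfolded has_field_derivative_def]])
      (auto intro!: derivative_eq_intros bounded_linear.has_derivative[OF bounded_linear_vec_nth])
  show "(\<lambda>x. flat_exp p (\<alpha> * x $ i + \<beta>)) \<in> ?C" by blast
  show "f differentiable at x" if "f \<in> ?C" for f x
    using that by (rule rangeE) (use * in \<open>auto simp: differentiable_def\<close>)
  show "partial j f \<in> ?C" if f: "f \<in> ?C" for f j
  proof -
    obtain p where p: "f = (\<lambda>x. flat_exp p (\<alpha> * x $ i + \<beta>))" using f by (rule rangeE)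
    \<comment> \<open>The inner derivative is a constant, zero unless j = i, and is absorbed into
      the polynomial so that the result stays in the class.\<close>
    have "partial j f = (\<lambda>x. flat_exp (Polynomial.smult (\<alpha> * axis j 1 $ i) ([:0, 0, 1:] * (p - pderiv p))) (\<alpha> * x $ i + \<beta>))"
      unfolding partial_def p frechet_derivative_at[OF *, symmetric]
      by (simp add: fun_eq_iff flat_exp_def)
    then show ?thesis by blast
  qed
qed

section \<open>The fundamental lemma of the calculus of variations\<close>

lemma smooth_const: "smooth (\<lambda>x. c)"
proof (rule smoothI_class)
  show "(\<lambda>x. c) \<in> range (\<lambda>c x. c)" by blast
  have "partial i (\<lambda>x. c) = (\<lambda>x. 0)" for i and c :: real
    using frechet_derivative_at[OF has_derivative_const, symmetric] by (simp add: partial_def)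
  then show "partial i f \<in> range (\<lambda>c x. c)" if "f \<in> range (\<lambda>c x. c)" for i f
    using that by auto
qed auto

lemma smooth_prod:
  assumes "\<And>i. i \<in> A \<Longrightarrow> smooth (f i)"
  shows "smooth (\<lambda>x. \<Prod>i\<in>A. f i x)"
  using assms by (induction A rule: infinite_finite_induct) (auto intro: smooth_const smooth_times)

lift_definition box_bump :: "nat \<Rightarrow> real^3 \<Rightarrow> real^3 \<Rightarrow> test_fun" is
  "\<lambda>n a b x. \<Prod>i\<in>UNIV. flat_exp 1 (real n * (x $ i - a $ i)) * flat_exp 1 (real n * (b $ i - x $ i))"
proof
  fix n a b
  have "smooth (\<lambda>x. flat_exp 1 (real n * (x $ i - a $ i)) * flat_exp 1 (real n * (b $ i - x $ i)))" for i
    using smooth_times[OF smooth_flat_exp[of 1 n i "- n * a $ i"] smooth_flat_exp[of 1 "- n" i "n * b $ i"]]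
    by (simp add: algebra_simps)
  then show "smooth (\<lambda>x. \<Prod>i\<in>UNIV. flat_exp 1 (real n * (x $ i - a $ i)) * flat_exp 1 (real n * (b $ i - x $ i)))"
    by (rule smooth_prod)
  show "compact (supp (\<lambda>x. \<Prod>i\<in>UNIV. flat_exp 1 (real n * (x $ i - a $ i)) * flat_exp 1 (real n * (b $ i - x $ i))))"
    by (rule compact_suppI[of "cbox a b"])
      (auto simp: mem_box_cart flat_exp_def not_le zero_less_mult_iff dest: less_asym)
qed

lemma box_bump_outside_box: "x \<notin> box a b \<Longrightarrow> test_app (box_bump n a b) x = 0"
  by (auto simp: box_bump.rep_eq mem_box_cart flat_exp_def zero_less_mult_iff)

lemma supp_box_bump: "supp (test_app (box_bump n a b)) \<subseteq> cbox a b"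
  by (subst supp_subset_iff) (use box_subset_cbox[of a b] in \<open>auto intro!: box_bump_outside_box\<close>)

lemma flat_exp_1_bounds: "0 \<le> flat_exp 1 t \<and> flat_exp 1 t \<le> 1"
  by (simp add: flat_exp_def)

lemma box_bump_bounds: "0 \<le> test_app (box_bump n a b) x \<and> test_app (box_bump n a b) x \<le> 1"
  unfolding box_bump.rep_eq
  by (intro conjI prod_nonneg prod_le_1 ballI mult_nonneg_nonneg mult_le_one) (simp_all add: flat_exp_1_bounds)

lemma box_bump_tendsto: "(\<lambda>n. test_app (box_bump n a b) x) \<longlonglongrightarrow> indicator (box a b) x"
proof (cases "x \<in> box a b")
  case True
  have lim: "(\<lambda>n. flat_exp 1 (real n * c)) \<longlonglongrightarrow> 1" if "0 < c" for c
  proof -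
    have "(\<lambda>n. exp (- (1 / (real n * c)))) \<longlonglongrightarrow> 1"
      using that by real_asymp
    \<comment> \<open>At n = 0 the two expressions differ: division by zero makes the exponential 1,
      whereas \<open>flat_exp\<close> is 0 there. They agree from n = 1 on.\<close>
    then show ?thesis
      by (rule Lim_transform_eventually)
        (use that in \<open>auto simp: flat_exp_def eventually_at_top_linorder intro!: exI[of _ 1]\<close>)
  qed
  have "(\<lambda>n. test_app (box_bump n a b) x) \<longlonglongrightarrow> (\<Prod>i\<in>(UNIV::3 set). 1 * 1)"
    unfolding box_bump.rep_eq using True
    by (intro tendsto_prod tendsto_mult lim) (auto simp: mem_box_cart)
  with True show ?thesis by simp
qed (simp add: box_bump_outside_box)

lemma square_integrable_indicator_box: "square_integrable (\<lambda>x. indicator (box a b) x :: real)"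
  unfolding square_integrable_def
proof
  have "(\<lambda>x. (norm (indicator (box a b) x :: real))\<^sup>2) = indicator (box a b)"
    by (auto simp: indicator_def)
  moreover have "integrable lborel (indicator (box a b) :: real^3 \<Rightarrow> real)"
    by (intro integrable_real_indicator emeasure_lborel_box_finite) simp
  ultimately show "integrable lborel (\<lambda>x. (norm (indicator (box a b) x :: real))\<^sup>2)"
    by simp
qed simp

text \<open>The bumps are dominated by the indicator of the box, and f times this indicator is
  integrable because both factors are square integrable; dominated convergence then applies. The
  closed box has to lie in \<Omega> since it is what bounds the supports of the bumps.\<close>

lemma box_integral_eq_0:
  assumes f: "square_integrable f"
    and zero: "\<And>\<phi>. supp (test_app \<phi>) \<subseteq> \<Omega> \<Longrightarrow> (LINT x|lborel. f x * test_app \<phi> x) = 0"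
    and "cbox a b \<subseteq> \<Omega>"
  shows "(LINT x:box a b|lborel. f x) = 0"
proof -
  have fm: "f \<in> borel_measurable lborel"
    using f by (simp add: square_integrable_def)
  have "(\<lambda>n. LINT x|lborel. f x * test_app (box_bump n a b) x) \<longlonglongrightarrow>
      (LINT x|lborel. f x * indicator (box a b) x)"
  proof (rule integral_dominated_convergence[where w = "\<lambda>x. \<bar>f x * indicator (box a b) x\<bar>"])
    from integrable_inner[OF f square_integrable_indicator_box] have "integrable lborel (\<lambda>x. f x * indicator (box a b) x)"
      by simp
    then show "integrable lborel (\<lambda>x. \<bar>f x * indicator (box a b) x\<bar>)"
      by (rule integrable_abs)
    show "AE x in lborel. (\<lambda>n. f x * test_app (box_bump n a b) x) \<longlonglongrightarrow> f x * indicator (box a b) x"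
      by (intro AE_I2 tendsto_mult tendsto_const box_bump_tendsto)
    show "AE x in lborel. norm (f x * test_app (box_bump n a b) x) \<le> \<bar>f x * indicator (box a b) x\<bar>" for n
    proof (rule AE_I2)
      fix x
      show "norm (f x * test_app (box_bump n a b) x) \<le> \<bar>f x * indicator (box a b) x\<bar>"
        using box_bump_bounds[of n a b x] box_bump_outside_box[of x a b n]
        by (cases "x \<in> box a b") (auto simp: abs_mult mult_left_le)
    qed
  qed (use fm square_integrable_test_app in \<open>auto simp: square_integrable_def intro!: borel_measurable_times\<close>)
  moreover have "(LINT x|lborel. f x * test_app (box_bump n a b) x) = 0" for n
    using supp_box_bump[of n a b] \<open>cbox a b \<subseteq> \<Omega>\<close> by (intro zero) simp
  ultimately have "(LINT x|lborel. f x * indicator (box a b) x) = 0"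
    by (simp add: LIMSEQ_const_iff)
  then show ?thesis
    by (simp add: set_lebesgue_integral_def mult.commute)
qed

text \<open>Dynkin's argument: open boxes are stable under intersection and generate the Borel sets.
  The whole space is not a box, so the vanishing of the total integral is a separate hypothesis; it
  serves the step to complements.\<close>

lemma AE_zero_if_box_integrals_zero:
  fixes g :: "'a::euclidean_space \<Rightarrow> real"
  assumes g: "integrable lborel g" and "(LINT x|lborel. g x) = 0"
    and box: "\<And>a b. (LINT x:box a b|lborel. g x) = 0"
  shows "AE x in lborel. g x = 0"
proof (rule sigma_finite_measure.density_zero[OF sigma_finite_lborel g])
  fix A :: "'a set"
  assume "A \<in> sets lborel"
  then have A: "A \<in> sigma_sets UNIV (range (\<lambda>(a, b). box a b))"
    by (simp add: borel_eq_box)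
  have "Int_stable (range (\<lambda>(a, b). box a b :: 'a set))"
    by (auto simp: Int_stable_def box_Int_box)
  moreover have "range (\<lambda>(a, b). box a b :: 'a set) \<subseteq> Pow UNIV"
    by simp
  ultimately show "(LINT x:A|lborel. g x) = 0"
    using A
  proof (induction rule: sigma_sets_induct_disjoint)
    case (compl A)
    then have [measurable]: "A \<in> sets borel" by (simp add: borel_eq_box)
    have int: "integrable lborel (\<lambda>x. indicator A x * g x)"
      using integrable_mult_indicator[OF _ g, of A] by simp
    have "(LINT x:UNIV - A|lborel. g x) = (LINT x|lborel. g x - indicator A x * g x)"
      unfolding set_lebesgue_integral_def
      by (rule Bochner_Integration.integral_cong) (auto simp: indicator_def)
    also have "\<dots> = 0"
      using compl int g assms(2) by (simp add: set_lebesgue_integral_def)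
    finally show ?case .
  next
    case (union A)
    then have [measurable]: "A i \<in> sets borel" for i by (auto simp: borel_eq_box)
    have "(LINT x:(\<Union>i. A i)|lborel. g x) = (\<Sum>i. (LINT x:A i|lborel. g x))"
    proof (rule lebesgue_integral_countable_add)
      show "A i \<inter> A j = {}" if "i \<noteq> j" for i j
        using union(1) that by (auto simp: disjoint_family_on_def)
      show "set_integrable lborel (\<Union>i. A i) g"
        unfolding set_integrable_def by (intro integrable_mult_indicator g) simp
    qed simp
    also have "\<dots> = 0" using union by simp
    finally show ?case .
  qed (use box in \<open>auto simp: set_lebesgue_integral_def\<close>)
qed

text \<open>A square-integrable f need not be integrable on \<Omega>, so the claim is proved on each
  open box whose closure lies in \<Omega>, where f is integrable, and then glued.\<close>

lemma du_Bois_Reymond: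
  assumes "open \<Omega>" "square_integrable f"
    and zero: "\<And>\<phi>. supp (test_app \<phi>) \<subseteq> \<Omega> \<Longrightarrow> (LINT x|lborel. f x * test_app \<phi> x) = 0"
  shows "AE x in lborel. x \<in> \<Omega> \<longrightarrow> f x = 0"
proof -
  have box: "(LINT x:box a b|lborel. f x) = 0" if "cbox a b \<subseteq> \<Omega>" for a b
    using box_integral_eq_0[of f \<Omega> a b] assms that by blast
  have local: "AE x in lborel. x \<in> box a b \<longrightarrow> f x = 0" if "cbox a b \<subseteq> \<Omega>" for a b
  proof -
    let ?g = "\<lambda>x. indicator (box a b) x * f x"
    have "AE x in lborel. ?g x = 0"
    proof (rule AE_zero_if_box_integrals_zero)
      from integrable_inner[OF square_integrable_indicator_box \<open>square_integrable f\<close>] show "integrable lborel ?g"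
        by simp
      show "(LINT x|lborel. ?g x) = 0"
        using box[OF that] by (simp add: set_lebesgue_integral_def)
      fix c d :: "real^3"
      \<comment> \<open>Restricting f to a fixed box turns integrals over arbitrary boxes into
        integrals over intersections. These are boxes with closure still in \<Omega>, so
        \<open>box\<close> covers them.\<close>
      let ?l = "\<chi> i. max (a $ i) (c $ i)" and ?u = "\<chi> i. min (b $ i) (d $ i)"
      have "cbox ?l ?u \<subseteq> cbox a b" "box a b \<inter> box c d = box ?l ?u"
        by (auto simp: mem_box_cart)
      with box[of ?l ?u] that have "(LINT x:box a b \<inter> box c d|lborel. f x) = 0"
        by auto
      then show "(LINT x:box c d|lborel. ?g x) = 0"
        by (simp add: set_lebesgue_integral_def indicator_inter_arith ac_simps)
    qed
    then show ?thesis by eventually_elim auto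
  qed
  have "\<Omega> = \<Union> {box a b |a b. cbox a b \<subseteq> \<Omega>}" (is "_ = \<Union> ?F")
  proof (rule set_eqI)
    fix x
    show "x \<in> \<Omega> \<longleftrightarrow> x \<in> \<Union> ?F"
    proof
      assume "x \<in> \<Omega>"
      then obtain a b where "cbox a b \<subseteq> \<Omega>" "x \<in> box a b"
        using open_contains_cbox[OF \<open>open \<Omega>\<close>] by metis
      then show "x \<in> \<Union> ?F" by blast
    qed (use box_subset_cbox in blast)
  qed
  \<comment> \<open>Null sets can be united only countably often; the Lindelof property reduces the
    cover of \<Omega> to countably many boxes.\<close>
  moreover obtain F where F: "F \<subseteq> ?F" "countable F" "\<Union> F = \<Union> ?F"
    using Lindelof[of ?F] by (auto intro: open_box)
  ultimately have "\<Omega> = \<Union> F" by simp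
  moreover have "AE x in lborel. \<forall>U\<in>F. x \<in> U \<longrightarrow> f x = 0"
    using F(1,2) local by (subst AE_ball_countable) auto
  ultimately show ?thesis
    by (auto elim: eventually_mono)
qed

lemma regular_dist_eq_0_imp:
  assumes "open \<Omega>" "u \<in> L2_on \<Omega>"
    and "\<And>\<phi>. supp (test_app \<phi>) \<subseteq> \<Omega> \<Longrightarrow> dist_app (regular_dist u) \<phi> = 0"
  shows "u = 0"
proof -
  have "vanishes_outside \<Omega> u" "\<forall>\<phi>. supp (test_app \<phi>) \<subseteq> \<Omega> \<longrightarrow> L2_test_pairing u \<phi> = 0"
    using assms by (auto simp: L2_on_def regular_dist.rep_eq)
  then show ?thesis
  proof (transfer fixing: \<Omega>)
    fix u :: "real^3 \<Rightarrow> real"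
    assume u: "ae_eq u u" "AE x in lborel. x \<notin> \<Omega> \<longrightarrow> u x = 0"
      "\<forall>\<phi>. supp (test_app \<phi>) \<subseteq> \<Omega> \<longrightarrow> (LINT x|lborel. u x * test_app \<phi> x) = 0"
    then have "AE x in lborel. x \<in> \<Omega> \<longrightarrow> u x = 0"
      by (intro du_Bois_Reymond[OF \<open>open \<Omega>\<close>]) (auto simp: ae_eq_def)
    with u(2) have "AE x in lborel. u x = 0"
      by eventually_elim auto
    with u(1) show "ae_eq u (\<lambda>x. 0)"
      by (simp add: ae_eq_def)
  qed
qed

section \<open>Weak differential operators on L2\<close>

lemma linear_L2_test_pairing:
  "L2_test_pairing (u + v) = (\<lambda>\<phi>. L2_test_pairing u \<phi> + L2_test_pairing v \<phi>)"
  "L2_test_pairing (c *\<^sub>R u) = (\<lambda>\<phi>. c * L2_test_pairing u \<phi>)"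
   by (transfer; auto simp: fun_eq_iff algebra_simps ae_eq_def
          intro!: Bochner_Integration.integral_add integrable_test_pairing)
      (transfer; simp add: fun_eq_iff algebra_simps)

lemma distribution_eqI: "(\<And>\<phi>. dist_app T \<phi> = dist_app U \<phi>) \<Longrightarrow> T = U"
  by (simp add: dist_app_inject[symmetric] fun_eq_iff)

lemma linear_dist_app: "linear (dist_app T)"
  using dist_app[of T] by simp

lemmas dist_app_simps = zero_distribution.rep_eq plus_distribution.rep_eq minus_distribution.rep_eq
  uminus_distribution.rep_eq scaleR_distribution.rep_eq dist_partial.rep_eq translate.rep_eq

lemma linear_dist_app_left: "linear (\<lambda>T. dist_app T \<phi>)"
  by (simp add: linear_iff dist_app_simps)

lemma linear_regular_dist: "linear regular_dist"
  unfolding linear_iff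
  by (auto intro!: distribution_eqI simp: dist_app_simps regular_dist.rep_eq linear_L2_test_pairing)

lemma linear_dist_partial: "linear (dist_partial i)"
  unfolding linear_iff by (auto intro!: distribution_eqI simp: dist_app_simps)

lemma linear_component: "linear (component i)"
  unfolding linear_iff
proof (intro conjI allI)
  have c: "square_integrable (\<lambda>x. f x $ i)" if "square_integrable f" for f :: "real^3 \<Rightarrow> real^3" and i
    using component.rsp that by (auto simp: rel_fun_def ae_eq_def)
  have m: "square_integrable (\<lambda>x. r * f x)" if "square_integrable f" for f :: "real^3 \<Rightarrow> real" and r
    using square_integrable_scaleR[OF that, of r] by simp
  show "component i (u + v) = component i u + component i v" for u v
    by transfer (auto simp: ae_eq_def intro!: c square_integrable_add)
  show "component i (r *\<^sub>R u) = r *\<^sub>R component i u" for r u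
    by transfer (auto simp: ae_eq_def intro!: c m)
qed

lemma subspace_L2_on: "subspace (L2_on \<Omega>)"
  unfolding subspace_def L2_on_def mem_Collect_eq
proof (intro conjI ballI allI)
  show "vanishes_outside \<Omega> 0" by transfer simp
  show "vanishes_outside \<Omega> (u + v)" if "u \<in> Collect (vanishes_outside \<Omega>)" "v \<in> Collect (vanishes_outside \<Omega>)"
    for u v :: "'a L2"
    using that unfolding mem_Collect_eq by transfer (auto elim: eventually_elim2)
  show "vanishes_outside \<Omega> (c *\<^sub>R u)" if "u \<in> Collect (vanishes_outside \<Omega>)" for u :: "'a L2" and c
    using that unfolding mem_Collect_eq by transfer (auto elim: eventually_mono)
qed

lemma component_L2_on: "u \<in> L2_on \<Omega> \<Longrightarrow> component i u \<in> L2_on \<Omega>"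
  unfolding L2_on_def mem_Collect_eq by transfer (auto elim: eventually_mono)

lemma component_eq_0_imp: "(\<And>i. component i u = 0) \<Longrightarrow> u = 0"
proof transfer
  fix u :: "real^3 \<Rightarrow> real^3"
  assume u: "ae_eq u u" "\<And>i. ae_eq (\<lambda>x. u x $ i) (\<lambda>x. 0)"
  then have "AE x in lborel. \<forall>i. u x $ i = 0"
    by (simp add: ae_eq_def eventually_all_finite)
  with u(1) show "ae_eq u (\<lambda>x. 0)"
    by (simp add: ae_eq_def vec_eq_iff)
qed

lemma linear_regular_dist_vec: "linear regular_dist_vec"
  unfolding linear_iff regular_dist_vec_def
  by (simp add: vec_eq_iff linear_add linear_scale linear_component linear_regular_dist)

lemma linear_curl: "linear curl"
  unfolding linear_iff curl_def
  by (simp add: vec_eq_iff forall_3 linear_add linear_scale linear_dist_partial algebra_simps)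

lemma linear_divergence: "linear divergence"
  unfolding linear_iff divergence_def
  by (simp add: linear_add linear_scale linear_dist_partial sum.distrib scaleR_right.sum)

lemma dist_partial_commute: "dist_partial i (dist_partial j T) = dist_partial j (dist_partial i T)"
  by (rule distribution_eqI) (simp add: dist_app_simps test_partial_commute[of i j])

lemma curl_grad: "curl (grad T) = 0"
  by (simp add: curl_def grad_def vec_eq_iff forall_3 dist_partial_commute[of 3 2]
      dist_partial_commute[of 3 1] dist_partial_commute[of 2 1])

lemma divergence_curl: "divergence (curl G) = 0"
  by (simp add: curl_def divergence_def sum_3 linear_diff[OF linear_dist_partial]
      dist_partial_commute[of 3 2] dist_partial_commute[of 3 1] dist_partial_commute[of 2 1])

section \<open>Agreement of distributions on \<Omega>\<close>

lemma dist_eq_on_sym: "dist_eq_on \<Omega> T U \<Longrightarrow> dist_eq_on \<Omega> U T"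
  and dist_eq_on_common: "dist_eq_on \<Omega> T U \<Longrightarrow> dist_eq_on \<Omega> T W \<Longrightarrow> dist_eq_on \<Omega> U W"
  and dist_vec_eq_on_common: "dist_vec_eq_on \<Omega> G H \<Longrightarrow> dist_vec_eq_on \<Omega> G K \<Longrightarrow> dist_vec_eq_on \<Omega> H K"
  and dist_eq_on_add: "dist_eq_on \<Omega> T U \<Longrightarrow> dist_eq_on \<Omega> T' U' \<Longrightarrow> dist_eq_on \<Omega> (T + T') (U + U')"
  and dist_eq_on_diff: "dist_eq_on \<Omega> T U \<Longrightarrow> dist_eq_on \<Omega> T' U' \<Longrightarrow> dist_eq_on \<Omega> (T - T') (U - U')"
  and dist_eq_on_scaleR: "dist_eq_on \<Omega> T U \<Longrightarrow> dist_eq_on \<Omega> (c *\<^sub>R T) (c *\<^sub>R U)"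
  by (auto simp: dist_eq_on_def dist_vec_eq_on_def dist_app_simps)

text \<open>Differentiation is local: it does not enlarge the support of a test function, so a test
  function on \<Omega> remains one.\<close>

lemma dist_eq_on_partial: "dist_eq_on \<Omega> T U \<Longrightarrow> dist_eq_on \<Omega> (dist_partial i T) (dist_partial i U)"
  unfolding dist_eq_on_def by (metis dist_partial.rep_eq order_trans supp_partial test_partial.rep_eq)

lemma dist_eq_on_curl: "dist_vec_eq_on \<Omega> G H \<Longrightarrow> dist_vec_eq_on \<Omega> (curl G) (curl H)"
  unfolding dist_vec_eq_on_def curl_def
  by (auto simp: forall_3 intro!: dist_eq_on_diff dist_eq_on_partial)

lemma dist_eq_on_divergence: "dist_vec_eq_on \<Omega> G H \<Longrightarrow> dist_eq_on \<Omega> (divergence G) (divergence H)"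
  unfolding dist_vec_eq_on_def divergence_def
  by (auto simp: sum_3 intro!: dist_eq_on_add dist_eq_on_partial)

lemma regular_dist_inject_on:
  assumes "open \<Omega>" "u \<in> L2_on \<Omega>" "v \<in> L2_on \<Omega>" "dist_eq_on \<Omega> (regular_dist u) (regular_dist v)"
  shows "u = v"
proof -
  have "u - v = 0"
    using assms
    by (intro regular_dist_eq_0_imp[of \<Omega>])
      (auto simp: subspace_diff subspace_L2_on dist_eq_on_def dist_app_simps linear_diff[OF linear_regular_dist])
  then show ?thesis by simp
qed

lemma regular_dist_vec_inject_on:
  assumes "open \<Omega>" "u \<in> L2_on \<Omega>" "v \<in> L2_on \<Omega>" "dist_vec_eq_on \<Omega> (regular_dist_vec u) (regular_dist_vec v)"
  shows "u = v"
proof -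
  have "component i u = component i v" for i
    using assms by (intro regular_dist_inject_on[of \<Omega>])
      (auto simp: component_L2_on dist_vec_eq_on_def regular_dist_vec_def)
  then have "u - v = 0"
    by (intro component_eq_0_imp) (simp add: linear_diff[OF linear_component])
  then show ?thesis by simp
qed

section \<open>Evaluation and linearity of the described operators, and the complex property\<close>

lemma grad_on_eq: "open \<Omega> \<Longrightarrow> has_grad_on \<Omega> u g \<Longrightarrow> grad_on \<Omega> u = g"
  unfolding grad_on_def has_grad_on_def
  by (rule the_equality)
    (auto intro: regular_dist_vec_inject_on dist_vec_eq_on_common)

lemma curl_on_eq: "open \<Omega> \<Longrightarrow> has_curl_on \<Omega> F G \<Longrightarrow> curl_on \<Omega> F = G"
  unfolding curl_on_def has_curl_on_def
  by (rule the_equality)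
    (auto intro: regular_dist_vec_inject_on dist_vec_eq_on_common)

lemma div_on_eq: "open \<Omega> \<Longrightarrow> has_div_on \<Omega> F d \<Longrightarrow> div_on \<Omega> F = d"
  unfolding div_on_def has_div_on_def
  by (rule the_equality) (auto intro: regular_dist_inject_on dist_eq_on_common)

text \<open>Linearity is established for the relations, where it is inherited from distributions;
  uniqueness carries it over to \<open>curl_on\<close> through \<open>curl_on_eq\<close>.\<close>

lemma has_curl_on_add: "has_curl_on \<Omega> F G \<Longrightarrow> has_curl_on \<Omega> F' G' \<Longrightarrow> has_curl_on \<Omega> (F + F') (G + G')"
  and has_curl_on_scaleR: "has_curl_on \<Omega> F G \<Longrightarrow> has_curl_on \<Omega> (c *\<^sub>R F) (c *\<^sub>R G)"
  by (auto simp: has_curl_on_def dist_vec_eq_on_def subspace_add subspace_scale subspace_L2_on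
      linear_add[OF linear_regular_dist_vec] linear_scale[OF linear_regular_dist_vec]
      linear_add[OF linear_curl] linear_scale[OF linear_curl]
      intro: dist_eq_on_add dist_eq_on_scaleR)

lemma has_div_on_add: "has_div_on \<Omega> F d \<Longrightarrow> has_div_on \<Omega> F' d' \<Longrightarrow> has_div_on \<Omega> (F + F') (d + d')"
  and has_div_on_scaleR: "has_div_on \<Omega> F d \<Longrightarrow> has_div_on \<Omega> (c *\<^sub>R F) (c *\<^sub>R d)"
  by (auto simp: has_div_on_def subspace_add subspace_scale subspace_L2_on
      linear_add[OF linear_regular_dist] linear_scale[OF linear_regular_dist]
      linear_add[OF linear_regular_dist_vec] linear_scale[OF linear_regular_dist_vec]
      linear_add[OF linear_divergence] linear_scale[OF linear_divergence]
      intro: dist_eq_on_add dist_eq_on_scaleR)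

text \<open>The field g is the distributional gradient of u on \<Omega> only, as jumps of u across
  the boundary are discarded. The identity curl grad = 0 on the whole space therefore has to be
  transported to g by locality.\<close>

lemma has_curl_on_grad:
  assumes "has_grad_on \<Omega> u g"
  shows "has_curl_on \<Omega> g 0"
proof -
  have "dist_vec_eq_on \<Omega> (curl (grad (regular_dist u))) (curl (regular_dist_vec g))"
    using assms by (intro dist_eq_on_curl) (simp add: has_grad_on_def)
  then show ?thesis
    by (auto simp: has_curl_on_def curl_grad linear_0[OF linear_regular_dist_vec] dist_vec_eq_on_def
        subspace_0 subspace_L2_on intro: dist_eq_on_sym)
qed

lemma has_div_on_curl:
  assumes "has_curl_on \<Omega> F G"
  shows "has_div_on \<Omega> G 0"
proof -
  have "dist_eq_on \<Omega> (divergence (curl (regular_dist_vec F))) (divergence (regular_dist_vec G))"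
    using assms by (intro dist_eq_on_divergence) (simp add: has_curl_on_def)
  then show ?thesis
    by (auto simp: has_div_on_def divergence_curl linear_0[OF linear_regular_dist]
        subspace_0 subspace_L2_on intro: dist_eq_on_sym)
qed

section \<open>Finite-dimensional subspaces of an inner product space\<close>

text \<open>The finite set in \<open>finite_dimensional\<close> may lie outside \<open>W\<close>. It
  still bounds the size of independent subsets of \<open>W\<close>, so a maximal one is a finite
  spanning set, to which Gram-Schmidt applies.\<close>

lemma finite_dimensional_orthogonal_basis:
  fixes W :: "'a::real_inner set"
  assumes "subspace W" "finite_dimensional W"
  obtains C where "finite C" "span C = W" "pairwise orthogonal C"
proof -
  obtain B where B: "finite B" "W \<subseteq> span B"
    using assms(2) by (auto simp: finite_dimensional_def)
  obtain D where D: "D \<subseteq> W" "independent D" "W \<subseteq> span D"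
    using maximal_independent_subset[of W] by blast
  then have "finite D"
    using independent_span_bound[OF B(1)] B(2) by blast
  moreover have "span D = W"
    using D assms(1) by (simp add: span_subspace)
  ultimately show thesis
    using basis_orthogonal[of D] that by auto
qed

lemma orthogonal_expansion:
  fixes C :: "'a::real_inner set"
  assumes "finite C" "pairwise orthogonal C" "v \<in> span C"
  shows "v = (\<Sum>c\<in>C. (v \<bullet> c / (c \<bullet> c)) *\<^sub>R c)"
proof -
  obtain r where r: "v = (\<Sum>c\<in>C. r c *\<^sub>R c)"
    using assms span_finite[of C] by auto
  have "v \<bullet> c = r c * (c \<bullet> c)" if "c \<in> C" for c
  proof -
    have "v \<bullet> c = (\<Sum>d\<in>C. if d = c then r c * (c \<bullet> c) else 0)"
      unfolding r inner_sum_left using assms(2) that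
      by (intro sum.cong) (auto simp: pairwise_def orthogonal_def)
    with that assms(1) show ?thesis by simp
  qed
  \<comment> \<open>The orthogonal set may contain the zero vector; its coefficient is a division by
    zero, and both sides vanish.\<close>
  then have "(v \<bullet> c / (c \<bullet> c)) *\<^sub>R c = r c *\<^sub>R c" if "c \<in> C" for c
    using that by (cases "c = 0") auto
  with r show ?thesis by (metis (no_types, lifting) sum.cong)
qed

text \<open>The extension is \<open>L\<close> after the orthogonal projection onto \<open>W\<close>.
  Its purpose is to make the derivative rules for bounded linear maps available to operators that
  are linear on \<open>W\<close> alone.\<close>

lemma subspace_bounded_linear_extension:
  fixes W :: "'a::real_inner set" and L :: "'a \<Rightarrow> 'b::real_normed_vector"
  assumes W: "subspace W" "finite_dimensional W"
    and add: "\<And>u v. u \<in> W \<Longrightarrow> v \<in> W \<Longrightarrow> L (u + v) = L u + L v"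
    and scale: "\<And>c u. u \<in> W \<Longrightarrow> L (c *\<^sub>R u) = c *\<^sub>R L u"
  obtains L' where "bounded_linear L'" "\<And>v. v \<in> W \<Longrightarrow> L' v = L v"
proof -
  obtain C where C: "finite C" "span C = W" "pairwise orthogonal C"
    using finite_dimensional_orthogonal_basis[OF W] by blast
  have CW: "c \<in> W" if "c \<in> C" for c
    using that C(2) span_base by blast
  have L0: "L 0 = 0" using scale[of 0 0] subspace_0[OF W(1)] by simp
  let ?L = "\<lambda>v. \<Sum>c\<in>C. (v \<bullet> c / (c \<bullet> c)) *\<^sub>R L c"
  have "bounded_linear ?L"
    by (intro bounded_linear_sum bounded_linear_scaleR_const
        bounded_linear_compose[OF bounded_linear_divide bounded_linear_inner_left])
  moreover have "?L v = L v" if "v \<in> W" for v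
  proof -
    have "L (\<Sum>c\<in>D. r c *\<^sub>R c) = (\<Sum>c\<in>D. r c *\<^sub>R L c)" if "D \<subseteq> C" for D r
      using finite_subset[OF that C(1)] that
    proof induction
      case (insert x F)
      then have "(\<Sum>c\<in>F. r c *\<^sub>R c) \<in> W" "r x *\<^sub>R x \<in> W" "x \<in> W"
        using CW W(1) by (auto intro!: subspace_sum subspace_scale)
      with insert show ?case by (simp add: add scale)
    qed (simp add: L0)
    from this[of C "\<lambda>c. v \<bullet> c / (c \<bullet> c)"] orthogonal_expansion[OF C(1,3), of v] C(2) that
    show ?thesis by simp
  qed
  ultimately show thesis by (rule that)
qed

lemma finite_dimensional_Riesz:
  fixes W :: "'a::real_inner set"
  assumes W: "subspace W" "finite_dimensional W"
    and add: "\<And>u v. u \<in> W \<Longrightarrow> v \<in> W \<Longrightarrow> f (u + v) = f u + f v"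
    and scale: "\<And>c u. u \<in> W \<Longrightarrow> f (c *\<^sub>R u) = c * (f u :: real)"
  shows "\<exists>!g. g \<in> W \<and> (\<forall>v\<in>W. g \<bullet> v = f v)"
proof (rule ex_ex1I)
  obtain C where C: "finite C" "span C = W" "pairwise orthogonal C"
    using finite_dimensional_orthogonal_basis[OF W] by blast
  have CW: "c \<in> W" if "c \<in> C" for c
    using that C(2) span_base by blast
  obtain f' where f': "bounded_linear f'" "\<And>v. v \<in> W \<Longrightarrow> f' v = f v"
    using subspace_bounded_linear_extension[OF W, of f] add scale by auto
  interpret f': bounded_linear f' by fact
  let ?g = "\<Sum>c\<in>C. (f c / (c \<bullet> c)) *\<^sub>R c"
  have "?g \<bullet> v = f v" if "v \<in> W" for v
  proof -
    have "f v = f' (\<Sum>c\<in>C. (v \<bullet> c / (c \<bullet> c)) *\<^sub>R c)"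
      using orthogonal_expansion[OF C(1,3), of v] C(2) that f'(2) by simp
    also have "\<dots> = ?g \<bullet> v"
      by (simp add: f'.sum f'.scale inner_sum_left inner_commute[of v] mult.commute f'(2) CW cong: sum.cong)
    finally show ?thesis by simp
  qed
  moreover have "?g \<in> W"
    using CW W(1) by (intro subspace_sum subspace_scale)
  ultimately show "\<exists>g. g \<in> W \<and> (\<forall>v\<in>W. g \<bullet> v = f v)" by blast
next
  fix g h
  assume *: "g \<in> W \<and> (\<forall>v\<in>W. g \<bullet> v = f v)" "h \<in> W \<and> (\<forall>v\<in>W. h \<bullet> v = f v)"
  then have "(g - h) \<bullet> (g - h) = 0"
    using subspace_diff[OF W(1), of g h] by (simp add: inner_diff_left)
  then show "g = h" by simp
qed

section \<open>Translations of distributions\<close>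

lemma test_app_simps: "test_app 0 = (\<lambda>x. 0)" "test_app (\<phi> + \<psi>) x = test_app \<phi> x + test_app \<psi> x"
  "test_app (\<phi> - \<psi>) x = test_app \<phi> x - test_app \<psi> x" "test_app (c *\<^sub>R \<phi>) x = c * test_app \<phi> x"
  "test_app (test_shift a \<phi>) x = test_app \<phi> (x + a)" "test_app (test_partial i \<phi>) = partial i (test_app \<phi>)"
  by (simp_all add: zero_test_fun.rep_eq plus_test_fun.rep_eq minus_test_fun.rep_eq scaleR_test_fun.rep_eq
      test_shift.rep_eq test_partial.rep_eq)

lemma test_app_sum: "test_app (\<Sum>i\<in>A. \<phi> i) x = (\<Sum>i\<in>A. test_app (\<phi> i) x)"
  by (induction A rule: infinite_finite_induct) (auto simp: test_app_simps)

section \<open>Iterated and directional derivatives of test functions\<close>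

definition test_partials :: "3 list \<Rightarrow> test_fun \<Rightarrow> test_fun" where
  "test_partials is \<phi> = foldr test_partial is \<phi>"

lemma test_partials_simps [simp]:
  "test_partials [] \<phi> = \<phi>" "test_partials (i # is) \<phi> = test_partial i (test_partials is \<phi>)"
  by (simp_all add: test_partials_def)

lemma test_app_test_partials: "test_app (test_partials is \<phi>) = partials is (test_app \<phi>)"
  by (induction "is") (simp_all add: test_app_simps)

lemma linear_test_partials: "linear (test_partials is)"
proof (induction "is")
  case (Cons i "is")
  then show ?case
    using linear_compose[OF Cons linear_test_partial[of i]] by (simp add: o_def)
qed (simp add: linear_iff)

lemma test_partials_shift: "test_partials is (test_shift a \<phi>) = test_shift a (test_partials is \<phi>)"
  by (induction "is") (simp_all add: test_partial_shift)

lemma test_partials_partial: "test_partials is (test_partial i \<phi>) = test_partial i (test_partials is \<phi>)"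
  by (induction "is") (simp_all add: test_partial_commute[of _ i])

definition test_directional :: "real^3 \<Rightarrow> test_fun \<Rightarrow> test_fun" where
  "test_directional d \<phi> = (\<Sum>i\<in>UNIV. d $ i *\<^sub>R test_partial i \<phi>)"

lemma test_partials_directional:
  "test_partials is (test_directional d \<phi>) = test_directional d (test_partials is \<phi>)"
  by (simp add: test_directional_def linear_sum[OF linear_test_partials] linear_scale[OF linear_test_partials]
      test_partials_partial)

lemma test_shift_directional:
  "test_shift a (test_directional d \<phi>) = test_directional d (test_shift a \<phi>)"
  by (simp add: test_directional_def linear_sum[OF linear_test_shift] linear_scale[OF linear_test_shift]
      test_partial_shift)

lemma test_shift_shift: "test_shift a (test_shift b \<phi>) = test_shift (a + b) \<phi>"
  by transfer (simp add: add.assoc)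

lemma DERIV_test_app:
  "((\<lambda>s. test_app \<phi> (x + s *\<^sub>R d)) has_real_derivative test_app (test_directional d \<phi>) (x + s *\<^sub>R d)) (at s)"
  using smooth_has_derivative_line[of "test_app \<phi>" x d s] test_app[of \<phi>]
  by (simp add: test_directional_def test_app_sum test_app_simps)

lemma uniformly_continuous_test_app: "uniformly_continuous_on UNIV (test_app \<phi>)"
  unfolding uniformly_continuous_on_def
proof (intro allI impI)
  fix e :: real
  assume "0 < e"
  have c: "continuous_on UNIV (test_app \<phi>)" and K: "compact (supp (test_app \<phi>))"
    using test_app[of \<phi>] by (auto intro: continuous_smooth)
  obtain R where R: "supp (test_app \<phi>) \<subseteq> cball 0 R"
    using compact_imp_bounded[OF K] by (auto simp: bounded_iff subset_iff)
  \<comment> \<open>The margin 1 matters: of two points at distance below 1, either both lie in the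
    larger ball or both lie outside the ball of radius R, where the test function vanishes.\<close>
  have "uniformly_continuous_on (cball 0 (R + 1)) (test_app \<phi>)"
    by (intro compact_uniformly_continuous continuous_on_subset[OF c]) auto
  then obtain \<delta> where \<delta>: "\<delta> > 0"
    "\<And>x y. x \<in> cball 0 (R + 1) \<Longrightarrow> y \<in> cball 0 (R + 1) \<Longrightarrow> dist y x < \<delta> \<Longrightarrow>
      dist (test_app \<phi> y) (test_app \<phi> x) < e"
    using \<open>0 < e\<close> by (rule uniformly_continuous_onE) blast
  have "dist (test_app \<phi> y) (test_app \<phi> x) < e" if "dist y x < min \<delta> 1" for x y
  proof (cases "x \<in> cball 0 (R + 1) \<and> y \<in> cball 0 (R + 1)")
    case False
    then have "norm x > R" "norm y > R"
      using that norm_triangle_ineq2[of x y] norm_triangle_ineq2[of y x]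
      by (auto simp: dist_norm norm_minus_commute)
    then have "test_app \<phi> x = 0" "test_app \<phi> y = 0"
      using R by (auto intro!: not_in_supp[where f = "test_app \<phi>"])
    then show ?thesis using \<open>0 < e\<close> by simp
  qed (use \<delta> that in auto)
  then show "\<exists>d>0. \<forall>x\<in>UNIV. \<forall>x'\<in>UNIV. dist x' x < d \<longrightarrow> dist (test_app \<phi> x') (test_app \<phi> x) < e"
    using \<delta>(1) by (intro exI[of _ "min \<delta> 1"]) auto
qed

text \<open>Subtracting from \<phi> along the line its linear part at x leaves a function whose
  derivative is an increment of the directional derivative. That increment is small uniformly in x
  by uniform continuity, and the mean value inequality finishes.\<close>

lemma difference_quotient_uniform_limit:
  assumes "h \<longlonglongrightarrow> 0" "\<And>n. h n \<noteq> 0"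
  shows "uniform_limit UNIV
    (\<lambda>n. test_app ((1 / h n) *\<^sub>R (test_shift (h n *\<^sub>R d) \<phi> - \<phi>) - test_directional d \<phi>)) (\<lambda>x. 0) sequentially"
  unfolding uniform_limit_iff
proof (intro allI impI)
  fix e :: real
  assume "0 < e"
  let ?g = "test_app (test_directional d \<phi>)"
  obtain \<delta> where \<delta>: "\<delta> > 0" "\<And>x y. dist y x < \<delta> \<Longrightarrow> dist (?g y) (?g x) < e / 2"
    using uniformly_continuous_test_app[of "test_directional d \<phi>"] \<open>0 < e\<close>
    unfolding uniformly_continuous_on_def by (metis UNIV_I half_gt_zero)
  have "(\<lambda>n. norm (h n *\<^sub>R d)) \<longlonglongrightarrow> 0"
    by (rule tendsto_norm_zero) (use tendsto_scaleR[OF assms(1) tendsto_const[of d]] in simp)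
  then have "\<forall>\<^sub>F n in sequentially. norm (h n *\<^sub>R d) < \<delta>"
    using \<delta>(1) by (rule order_tendstoD)
  then show "\<forall>\<^sub>F n in sequentially. \<forall>x\<in>UNIV.
      dist (test_app ((1 / h n) *\<^sub>R (test_shift (h n *\<^sub>R d) \<phi> - \<phi>) - test_directional d \<phi>) x) 0 < e"
  proof eventually_elim
    case (elim n)
    show ?case
    proof
      fix x
      let ?k = "\<lambda>s. test_app \<phi> (x + s *\<^sub>R d) - s * ?g x"
      have "norm (?k (h n) - ?k 0) \<le> e / 2 * norm (h n - 0)"
      proof (rule field_differentiable_bound[where S = "closed_segment 0 (h n)"])
        fix s
        assume s: "s \<in> closed_segment 0 (h n)"
        show "(?k has_field_derivative ?g (x + s *\<^sub>R d) - ?g x) (at s within closed_segment 0 (h n))"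
          by (rule DERIV_subset[of _ _ _ UNIV])
            (auto intro!: derivative_eq_intros DERIV_test_app)
        have "\<bar>s\<bar> \<le> \<bar>h n\<bar>"
          using s by (auto simp: closed_segment_eq_real_ivl split: if_splits)
        then have "norm (s *\<^sub>R d) \<le> norm (h n *\<^sub>R d)"
          by (simp add: mult_right_mono)
        with elim show "norm (?g (x + s *\<^sub>R d) - ?g x) \<le> e / 2"
          using \<delta>(2)[of "x + s *\<^sub>R d" x] by (simp add: dist_norm)
      qed auto
      then have "\<bar>test_app \<phi> (x + h n *\<^sub>R d) - h n * ?g x - test_app \<phi> x\<bar> / \<bar>h n\<bar> \<le> e / 2"
        using assms(2)[of n] by (simp add: pos_divide_le_eq)
      also have "\<bar>test_app \<phi> (x + h n *\<^sub>R d) - h n * ?g x - test_app \<phi> x\<bar> / \<bar>h n\<bar> =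
          \<bar>(1 / h n) * (test_app \<phi> (x + h n *\<^sub>R d) - test_app \<phi> x) - ?g x\<bar>"
        unfolding abs_divide[symmetric] using assms(2)[of n] by (simp add: field_simps)
      finally show "dist (test_app ((1 / h n) *\<^sub>R (test_shift (h n *\<^sub>R d) \<phi> - \<phi>) - test_directional d \<phi>) x) 0 < e"
        using \<open>0 < e\<close> by (simp add: test_app_simps)
    qed
  qed
qed

text \<open>Iterated partials commute with shifts and directional derivatives, so each of them
  reduces to the uniform limit for another test function. The common compact set is the support of
  \<phi> swept along d for parameters in the range of the bounded sequence h.\<close>

lemma difference_quotient_test_seq_to_zero:
  assumes "h \<longlonglongrightarrow> 0" "\<And>n. h n \<noteq> 0"
  shows "test_seq_to_zero (\<lambda>n. (1 / h n) *\<^sub>R (test_shift (h n *\<^sub>R d) \<phi> - \<phi>) - test_directional d \<phi>)"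
  unfolding test_seq_to_zero_def
proof (intro conjI allI)
  let ?q = "\<lambda>n. (1 / h n) *\<^sub>R (test_shift (h n *\<^sub>R d) \<phi> - \<phi>) - test_directional d \<phi>"
  obtain M where M: "\<And>n. \<bar>h n\<bar> \<le> M"
    using Bseq_eq_bounded[of h] convergent_imp_Bseq[OF convergentI[OF assms(1)]]
    by (auto simp: Bseq_def)
  let ?K = "(\<lambda>(x, s). x - s *\<^sub>R d) ` (supp (test_app \<phi>) \<times> {-M..M})"
  have "compact ?K"
    using test_app[of \<phi>]
    by (intro compact_continuous_image compact_Times)
      (auto intro!: continuous_intros simp: case_prod_unfold)
  moreover have "supp (test_app (?q n)) \<subseteq> ?K" for n
  proof (subst supp_subset_iff)
    show "closed ?K" using \<open>compact ?K\<close> by (rule compact_imp_closed)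
    show "\<forall>x. x \<notin> ?K \<longrightarrow> test_app (?q n) x = 0"
    proof (intro allI impI)
      fix x
      assume x: "x \<notin> ?K"
      have *: "x + s *\<^sub>R d \<notin> supp (test_app \<phi>)" if "\<bar>s\<bar> \<le> M" for s
        using x that by (force simp: image_iff)
      from *[of 0] *[of "h n"] M[of n] have "x \<notin> supp (test_app \<phi>)" "x + h n *\<^sub>R d \<notin> supp (test_app \<phi>)"
        by auto
      then show "test_app (?q n) x = 0"
        by (simp add: test_app_simps test_directional_def test_app_sum not_in_supp partial_outside_supp)
    qed
  qed
  ultimately show "\<exists>K. compact K \<and> (\<forall>n. supp (test_app (?q n)) \<subseteq> K)" by blast
  show "uniform_limit UNIV (\<lambda>n. partials is (test_app (?q n))) (\<lambda>x. 0) sequentially" for "is"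
  proof -
    have "partials is (test_app (?q n)) =
        test_app ((1 / h n) *\<^sub>R (test_shift (h n *\<^sub>R d) (test_partials is \<phi>) - test_partials is \<phi>)
          - test_directional d (test_partials is \<phi>))" for n
      unfolding test_app_test_partials[symmetric]
      by (simp add: linear_diff[OF linear_test_partials] linear_scale[OF linear_test_partials]
          test_partials_shift test_partials_directional)
    then show ?thesis
      using difference_quotient_uniform_limit[OF assms] by simp
  qed
qed

lemma translate_translate: "translate a (translate b T) = translate (a + b) T"
  by (rule distribution_eqI) (simp add: dist_app_simps test_shift_shift add.commute)

lemma translate_0 [simp]: "translate 0 T = T"
proof -
  have "test_shift 0 \<phi> = \<phi>" for \<phi> by transfer simp
  then show ?thesis by (intro distribution_eqI) (simp add: dist_app_simps)
qed

lemma linear_translate: "linear (translate a)"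
  unfolding linear_iff by (auto intro!: distribution_eqI simp: dist_app_simps)

lemma dist_partial_translate: "dist_partial i (translate a T) = translate a (dist_partial i T)"
  by (rule distribution_eqI) (simp add: dist_app_simps test_partial_shift)

lemma divergence_vec_times:
  "divergence (vec_times d T) = (\<Sum>i\<in>UNIV. d $ i *\<^sub>R dist_partial i T)"
  by (simp add: divergence_def vec_times_def linear_scale[OF linear_dist_partial])

lemma divergence_vec_times_translate:
  "divergence (vec_times d (translate a T)) = translate a (divergence (vec_times d T))"
  by (simp add: divergence_vec_times dist_partial_translate linear_sum[OF linear_translate]
      linear_scale[OF linear_translate])

lemma dist_app_divergence_vec_times:
  "dist_app (divergence (vec_times d T)) \<phi> = - dist_app T (test_directional d \<phi>)"
  unfolding divergence_vec_times test_directional_def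
  by (simp add: linear_sum[OF linear_dist_app_left] linear_sum[OF linear_dist_app] dist_app_simps
      linear_scale[OF linear_dist_app] sum_negf)

text \<open>Tested with \<phi>, the translate is always differentiable, whatever the space
  \<open>V\<close>. Moving the directional derivative from the test function to T produces the minus
  sign.\<close>

lemma DERIV_dist_app_translate:
  "((\<lambda>s. dist_app (translate (x + s *\<^sub>R d) T) \<phi>) has_real_derivative
    - dist_app (translate (x + s *\<^sub>R d) (divergence (vec_times d T))) \<phi>) (at s)"
proof -
  let ?\<psi> = "test_shift (x + s *\<^sub>R d) \<phi>"
  interpret T: linear "dist_app T" by (rule linear_dist_app)
  \<comment> \<open>Distributions are continuous along sequences by definition, so the limit at 0 is
    taken along arbitrary null sequences.\<close>
  have "(\<lambda>n. (dist_app T (test_shift (h n *\<^sub>R d) ?\<psi>) - dist_app T ?\<psi>) / h n) \<longlonglongrightarrow>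
      dist_app T (test_directional d ?\<psi>)" if "h \<longlonglongrightarrow> 0" "\<And>n. h n \<noteq> 0" for h
  proof -
    have "(\<lambda>n. dist_app T ((1 / h n) *\<^sub>R (test_shift (h n *\<^sub>R d) ?\<psi> - ?\<psi>) - test_directional d ?\<psi>)) \<longlonglongrightarrow> 0"
      using difference_quotient_test_seq_to_zero[OF that] dist_app[of T] by blast
    then have "(\<lambda>n. (dist_app T (test_shift (h n *\<^sub>R d) ?\<psi>) - dist_app T ?\<psi>) / h n - dist_app T (test_directional d ?\<psi>)) \<longlonglongrightarrow> 0"
      by (simp add: T.diff T.scale)
    then show ?thesis by (simp add: LIM_zero_iff)
  qed
  then have "((\<lambda>h. (dist_app T (test_shift (h *\<^sub>R d) ?\<psi>) - dist_app T ?\<psi>) / h) \<longlongrightarrow>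
      dist_app T (test_directional d ?\<psi>)) (at 0)"
    by (auto simp: tendsto_at_iff_sequentially o_def)
  then show ?thesis
    by (simp add: DERIV_def dist_app_simps test_shift_shift dist_app_divergence_vec_times
        test_shift_directional algebra_simps)
qed

section \<open>Riemann sums with respect to seminorms\<close>

lemma
  assumes "seminorm_on V p" "subspace V"
  shows seminorm_on_0: "p 0 = 0"
    and seminorm_on_minus: "u \<in> V \<Longrightarrow> p (- u) = p u"
    and seminorm_on_scale: "u \<in> V \<Longrightarrow> p (c *\<^sub>R u) = \<bar>c\<bar> * p u"
    and seminorm_on_triangle: "u \<in> V \<Longrightarrow> v \<in> V \<Longrightarrow> p (u + v) \<le> p u + p v"
    and seminorm_on_sum: "(\<And>i. i \<in> A \<Longrightarrow> w i \<in> V) \<Longrightarrow> p (\<Sum>i\<in>A. w i) \<le> (\<Sum>i\<in>A. p (w i))"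
proof -
  show scale: "p (c *\<^sub>R u) = \<bar>c\<bar> * p u" if "u \<in> V" for c u
    using assms(1) that by (auto simp: seminorm_on_def)
  show zero: "p 0 = 0"
    using scale[of 0 0] subspace_0[OF assms(2)] by simp
  show "p (- u) = p u" if "u \<in> V"
    using scale[OF that, of "-1"] by simp
  show tri: "p (u + v) \<le> p u + p v" if "u \<in> V" "v \<in> V" for u v
    using assms(1) that by (auto simp: seminorm_on_def)
  show "p (\<Sum>i\<in>A. w i) \<le> (\<Sum>i\<in>A. p (w i))" if "\<And>i. i \<in> A \<Longrightarrow> w i \<in> V"
    using that
  proof (induction A rule: infinite_finite_induct)
    case (insert x F)
    then have "p (w x + sum w F) \<le> p (w x) + p (sum w F)"
      by (intro tri subspace_sum[OF assms(2)]) auto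
    with insert show ?case by fastforce
  qed (simp_all add: zero)
qed

lemma seminorm_on_diff_commute:
  assumes "seminorm_on V p" "subspace V" "u \<in> V" "v \<in> V"
  shows "p (u - v) = p (v - u)"
  using seminorm_on_minus[OF assms(1,2) subspace_diff[OF assms(2,3,4)]] by simp

lemma seminorm_on_diff_triangle:
  assumes "seminorm_on V p" "subspace V" "u \<in> V" "v \<in> V" "w \<in> V"
  shows "p (u - w) \<le> p (u - v) + p (v - w)"
  using seminorm_on_triangle[OF assms(1,2), of "u - v" "v - w"] subspace_diff[OF assms(2)] assms(3-)
  by simp

lemma seminorm_on_comp_linear:
  assumes "\<And>u v. u \<in> V \<Longrightarrow> v \<in> V \<Longrightarrow> L (u + v) = L u + L v"
    and "\<And>c u. u \<in> V \<Longrightarrow> L (c *\<^sub>R u) = c *\<^sub>R L u"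
  shows "seminorm_on V (\<lambda>u. norm (L u))"
  using assms by (auto simp: seminorm_on_def norm_triangle_ineq)

text \<open>Heine-Cantor for a function into a space known only through a seminorm: it is applied to
  the real function p(f s - f t) on the unit square, which vanishes on the diagonal, by comparing
  (s, t) with (s, s).\<close>

lemma seminorm_on_uniformly_continuous:
  fixes f :: "real \<Rightarrow> 'a::real_vector"
  assumes p: "seminorm_on V p" "subspace V" and fV: "\<And>s. f s \<in> V"
    and cont: "\<And>s. ((\<lambda>t. p (f t - f s)) \<longlongrightarrow> 0) (at s)" and "0 < e"
  obtains \<delta> where "\<delta> > 0" "\<And>s t. s \<in> {0..1} \<Longrightarrow> t \<in> {0..1} \<Longrightarrow> \<bar>s - t\<bar> < \<delta> \<Longrightarrow> p (f s - f t) < e"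
proof -
  let ?h = "\<lambda>(s, t). p (f s - f t)"
  have sub: "f s - f t \<in> V" for s t
    using fV subspace_diff[OF p(2)] by blast
  note p0 = seminorm_on_0[OF p] and tri = seminorm_on_diff_triangle[OF p fV fV fV]
    and comm = seminorm_on_diff_commute[OF p fV fV]
  have lim: "((\<lambda>t. p (f t - f s)) \<longlongrightarrow> 0) (nhds s)" for s
    using cont[of s] p0 by (simp add: tendsto_nhds_iff)
  have "isCont ?h z" for z
  proof -
    obtain s t where z: "z = (s, t)" by fastforce
    have s: "((\<lambda>y. p (f (fst y) - f s)) \<longlongrightarrow> 0) (at z)"
      by (rule filterlim_compose[OF lim]) (use tendsto_fst[OF tendsto_ident_at, of z UNIV] z in simp)
    have t: "((\<lambda>y. p (f (snd y) - f t)) \<longlongrightarrow> 0) (at z)"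
      by (rule filterlim_compose[OF lim]) (use tendsto_snd[OF tendsto_ident_at, of z UNIV] z in simp)
    have "((\<lambda>y. ?h y - ?h z) \<longlongrightarrow> 0) (at z)"
    proof (rule Lim_null_comparison)
      show "((\<lambda>y. p (f (fst y) - f s) + p (f (snd y) - f t)) \<longlongrightarrow> 0) (at z)"
        using tendsto_add[OF s t] by simp
      have "norm (?h y - ?h z) \<le> p (f (fst y) - f s) + p (f (snd y) - f t)" for y
        using tri[of "fst y" "snd y" s] tri[of s "snd y" t] tri[of s t "fst y"] tri[of "fst y" t "snd y"]
          comm[of s "fst y"] comm[of "snd y" t]
        by (auto simp: z case_prod_unfold abs_le_iff)
      then show "\<forall>\<^sub>F y in at z. norm (?h y - ?h z) \<le> p (f (fst y) - f s) + p (f (snd y) - f t)"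
        by (rule always_eventually[OF allI])
    qed
    then show ?thesis
      unfolding isCont_def by (rule LIM_zero_cancel)
  qed
  then have "uniformly_continuous_on ({0..1} \<times> {0..1}) ?h"
    by (intro compact_uniformly_continuous compact_Times continuous_at_imp_continuous_on) auto
  then obtain \<delta> where \<delta>: "\<delta> > 0" "\<And>y z. y \<in> {0..1} \<times> {0..1} \<Longrightarrow> z \<in> {0..1} \<times> {0..1} \<Longrightarrow>
      dist z y < \<delta> \<Longrightarrow> dist (?h z) (?h y) < e"
    using \<open>0 < e\<close> by (rule uniformly_continuous_onE) blast
  show thesis
  proof (rule that[OF \<delta>(1)])
    fix s t :: real
    assume "s \<in> {0..1}" "t \<in> {0..1}" "\<bar>s - t\<bar> < \<delta>"
    then have "dist (?h (s, t)) (?h (s, s)) < e"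
      by (intro \<delta>(2)) (auto simp: dist_Pair_Pair dist_real_def)
    then show "p (f s - f t) < e" by (simp add: p0)
  qed
qed

text \<open>Left endpoints on the unit interval. Division by zero makes the sum 0 at n = 0, so the
  sequences below are indexed by \<open>Suc n\<close>.\<close>

definition riemann_sum :: "(real \<Rightarrow> 'a::real_vector) \<Rightarrow> nat \<Rightarrow> 'a" where
  "riemann_sum f n = (1 / real n) *\<^sub>R (\<Sum>k<n. f (real k / real n))"

lemma riemann_sum_in_subspace: "subspace V \<Longrightarrow> (\<And>s. f s \<in> V) \<Longrightarrow> riemann_sum f n \<in> V"
  unfolding riemann_sum_def by (intro subspace_scale subspace_sum)

text \<open>Each coarse term is repeated m times with weight 1/(nm): the fine index j belongs to the
  coarse interval \<open>j div m\<close>, whose left end is within 1/n of the fine node. The two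
  sums then differ by an average of oscillations.\<close>

lemma seminorm_riemann_sum_refine:
  fixes f :: "real \<Rightarrow> 'a::real_vector"
  assumes p: "seminorm_on V p" "subspace V" and fV: "\<And>s. f s \<in> V"
    and osc: "\<And>s t. s \<in> {0..1} \<Longrightarrow> t \<in> {0..1} \<Longrightarrow> \<bar>s - t\<bar> \<le> 1 / n \<Longrightarrow> p (f s - f t) \<le> e"
    and "0 < n" "0 < m"
  shows "p (riemann_sum f n - riemann_sum f (n * m)) \<le> e"
proof -
  have nm: "real n * real m > 0" using assms by simp
  have "(\<Sum>j<n * m. f (real (j div m) / n)) = (\<Sum>k<n. \<Sum>j\<in>{k * m..<k * m + m}. f (real (j div m) / n))"
    by (simp add: sum.nat_group)
  also have "\<dots> = (\<Sum>k<n. \<Sum>j\<in>{k * m..<k * m + m}. f (real k / n))"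
  proof (intro sum.cong refl)
    fix k j
    assume "j \<in> {k * m..<k * m + m}"
    then have "j div m = k"
      by (intro div_nat_eqI) (auto simp: algebra_simps)
    then show "f (real (j div m) / n) = f (real k / n)" by simp
  qed
  also have "\<dots> = real m *\<^sub>R (\<Sum>k<n. f (real k / n))"
    by (simp add: scaleR_right.sum sum_constant_scaleR)
  finally have "riemann_sum f n = (1 / (n * m)) *\<^sub>R (\<Sum>j<n * m. f (real (j div m) / n))"
    using assms by (simp add: riemann_sum_def)
  then have "riemann_sum f n - riemann_sum f (n * m) =
      (1 / (n * m)) *\<^sub>R (\<Sum>j<n * m. f (real (j div m) / n) - f (real j / real (n * m)))"
    by (simp add: riemann_sum_def sum_subtractf scaleR_diff_right)
  then have "p (riemann_sum f n - riemann_sum f (n * m)) =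
      (1 / (n * m)) * p (\<Sum>j<n * m. f (real (j div m) / n) - f (real j / real (n * m)))"
    using fV p(2) by (simp add: seminorm_on_scale[OF p] subspace_sum subspace_diff)
  also have "\<dots> \<le> (1 / (n * m)) * (\<Sum>j<n * m. p (f (real (j div m) / n) - f (real j / real (n * m))))"
    using fV p(2) nm by (intro mult_left_mono seminorm_on_sum[OF p] subspace_diff) auto
  also have "\<dots> \<le> (1 / (n * m)) * (\<Sum>j<n * m. e)"
  proof (intro mult_left_mono sum_mono osc)
    fix j
    assume "j \<in> {..<n * m}"
    then have j: "j < n * m" by simp
    then show "real j / real (n * m) \<in> {0..1}"
      using nm by (auto simp: divide_le_eq simp flip: of_nat_mult)
    have "j div m < n" using j \<open>0 < m\<close> by (simp add: div_less_iff_less_mult)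
    then show "real (j div m) / real n \<in> {0..1}" by simp
    have "real j = real m * real (j div m) + real (j mod m)"
      by (metis mult_div_mod_eq of_nat_add of_nat_mult)
    moreover have "real (j mod m) \<le> real m" using \<open>0 < m\<close> by (simp add: less_imp_le)
    ultimately show "\<bar>real (j div m) / real n - real j / real (n * m)\<bar> \<le> 1 / real n"
      using nm \<open>0 < n\<close> \<open>0 < m\<close> by (simp add: field_simps abs_le_iff)
  qed (use nm in auto)
  also have "\<dots> = e" using assms by simp
  finally show ?thesis .
qed

section \<open>Derivative of a translated shape under a continuous operator\<close>

locale translation_invariant_function_space =
  fixes V :: "distribution set" and P :: "(distribution \<Rightarrow> real) set"
  assumes subspace: "subspace V"
    and translate_in: "G \<in> V \<Longrightarrow> translate a G \<in> V"
    and function_space: "function_space V P"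
begin

text \<open>Formulated for a single seminorm, so that it covers not only the members of
  \<open>P\<close> but also \<open>norm (L u)\<close> for a continuous operator
  \<open>L\<close>.\<close>

definition translation_continuous :: "(distribution \<Rightarrow> real) \<Rightarrow> bool" where
  "translation_continuous p \<longleftrightarrow>
    seminorm_on V p \<and> (\<forall>G\<in>V. ((\<lambda>a. p (translate a G - G)) \<longlongrightarrow> 0) (at 0))"

lemma translation_continuous_P: "p \<in> P \<Longrightarrow> translation_continuous p"
  using function_space by (simp add: translation_continuous_def function_space_def)

text \<open>Translations form a group, so continuity at 0 for \<open>translate a G\<close> is
  continuity at a for \<open>G\<close>. The limit includes the point a itself, which lets it be
  composed with any convergent curve.\<close>

lemma translation_continuous_nhds:
  assumes "translation_continuous p" "G \<in> V"
  shows "((\<lambda>b. p (translate b G - translate a G)) \<longlongrightarrow> 0) (nhds a)"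
proof -
  have p: "seminorm_on V p"
    using assms by (simp add: translation_continuous_def)
  have "((\<lambda>h. p (translate h (translate a G) - translate a G)) \<longlongrightarrow> 0) (at 0)"
    using assms translate_in by (simp add: translation_continuous_def)
  then have "((\<lambda>b. p (translate b G - translate a G)) \<longlongrightarrow> 0) (at a)"
    by (subst LIM_offset_zero_iff) (simp_all add: translate_translate add.commute)
  then show ?thesis
    by (simp add: tendsto_nhds_iff seminorm_on_0[OF p subspace])
qed

lemma translation_continuous_line:
  assumes "translation_continuous p" "G \<in> V"
  shows "((\<lambda>t. p (translate (x + t *\<^sub>R d) G - translate (x + s *\<^sub>R d) G)) \<longlongrightarrow> 0) (at s)"
  by (rule filterlim_compose[OF translation_continuous_nhds[OF assms]]) (intro tendsto_intros)

end

locale continuous_operator = translation_invariant_function_space +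
  fixes L :: "distribution \<Rightarrow> 'b::real_normed_vector"
  assumes L_add: "G \<in> V \<Longrightarrow> H \<in> V \<Longrightarrow> L (G + H) = L G + L H"
    and L_scale: "G \<in> V \<Longrightarrow> L (c *\<^sub>R G) = c *\<^sub>R L G"
    and L_continuous: "seminorm_continuous V P L"
begin

lemma L_0: "L 0 = 0"
  using L_scale[of 0 0] subspace_0[OF subspace] by simp

lemma L_diff: "G \<in> V \<Longrightarrow> H \<in> V \<Longrightarrow> L (G - H) = L G - L H"
  using L_add[of G "- 1 *\<^sub>R H"] L_scale[of H "-1"] subspace_scale[OF subspace, of H "-1"] by simp

lemma L_sum: "(\<And>i. i \<in> A \<Longrightarrow> G i \<in> V) \<Longrightarrow> L (\<Sum>i\<in>A. G i) = (\<Sum>i\<in>A. L (G i))"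
  by (induction A rule: infinite_finite_induct) (auto simp: L_0 L_add subspace_sum[OF subspace])

lemma L_tendsto_0:
  assumes "\<And>i. G i \<in> V" "\<And>p. p \<in> P \<Longrightarrow> ((\<lambda>i. p (G i)) \<longlongrightarrow> 0) F"
  shows "((\<lambda>i. L (G i)) \<longlongrightarrow> 0) F"
proof -
  obtain Q C where Q: "finite Q" "Q \<subseteq> P" "\<And>u. u \<in> V \<Longrightarrow> norm (L u) \<le> C * (\<Sum>p\<in>Q. p u)"
    using L_continuous by (auto simp: seminorm_continuous_def)
  show ?thesis
  proof (rule Lim_null_comparison)
    show "\<forall>\<^sub>F i in F. norm (L (G i)) \<le> C * (\<Sum>p\<in>Q. p (G i))"
      using Q(3) assms(1) by simp
    show "((\<lambda>i. C * (\<Sum>p\<in>Q. p (G i))) \<longlongrightarrow> 0) F"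
      using Q(2) assms(2) by (intro tendsto_mult_right_zero tendsto_null_sum) auto
  qed
qed

lemma translation_continuous_norm_L: "translation_continuous (\<lambda>u. norm (L u))"
  unfolding translation_continuous_def
proof (intro conjI ballI)
  show "seminorm_on V (\<lambda>u. norm (L u))"
    by (rule seminorm_on_comp_linear) (simp_all add: L_add L_scale)
  fix G
  assume "G \<in> V"
  then show "((\<lambda>a. norm (L (translate a G - G))) \<longlongrightarrow> 0) (at 0)"
    using function_space
    by (intro tendsto_norm_zero L_tendsto_0 subspace_diff[OF subspace] translate_in)
      (auto simp: function_space_def)
qed

end

context translation_invariant_function_space
begin

text \<open>Evaluations at test functions become instances of \<open>L\<close>, so convergence in
  the seminorms implies convergence as distributions.\<close>

lemma continuous_operator_dist_app: "continuous_operator V P (\<lambda>u. dist_app u \<phi>)"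
  using function_space by unfold_locales (auto simp: function_space_def dist_app_simps)

context
  fixes x d :: "real^3" and S :: distribution
  assumes S: "S \<in> V" and dS: "divergence (vec_times d S) \<in> V"
begin

private abbreviation path :: "real \<Rightarrow> distribution" where
  "path s \<equiv> translate (x + s *\<^sub>R d) (divergence (vec_times d S))"

private lemma path_in: "path s \<in> V"
  using dS by (rule translate_in)

private lemma path_uniformly_continuous:
  assumes "translation_continuous p" "0 < e"
  obtains M :: nat where "0 < M"
    "\<And>n s t. M \<le> n \<Longrightarrow> s \<in> {0..1} \<Longrightarrow> t \<in> {0..1} \<Longrightarrow> \<bar>s - t\<bar> \<le> 1 / real n \<Longrightarrow> p (path s - path t) \<le> e"
proof -
  have p: "seminorm_on V p" using assms(1) by (simp add: translation_continuous_def)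
  obtain \<delta> where \<delta>: "\<delta> > 0"
    "\<And>s t. s \<in> {0..1} \<Longrightarrow> t \<in> {0..1} \<Longrightarrow> \<bar>s - t\<bar> < \<delta> \<Longrightarrow> p (path s - path t) < e"
    using seminorm_on_uniformly_continuous[OF p subspace, of path e]
      translation_continuous_line[OF assms(1) dS] path_in \<open>0 < e\<close> by blast
  obtain M where M: "0 < M" "1 / real M < \<delta>"
    using reals_Archimedean[OF \<delta>(1)] by (metis inverse_eq_divide zero_less_Suc)
  show thesis
  proof (rule that[OF M(1)])
    fix n s t
    assume "M \<le> n" "s \<in> {0..1}" "t \<in> {0..1}" "\<bar>s - t\<bar> \<le> 1 / real n"
    moreover have "1 / real n \<le> 1 / real M"
      using \<open>M \<le> n\<close> M(1) by (simp add: frac_le)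
    ultimately show "p (path s - path t) \<le> e"
      using \<delta>(2)[of s t] M(2) by simp
  qed
qed

private lemma riemann_sum_in: "riemann_sum path n \<in> V"
  by (intro riemann_sum_in_subspace subspace path_in)

text \<open>Two sums are compared through their common refinement with \<open>Suc j * Suc k\<close>
  intervals; two errors of at most e/3 leave room for the strict inequality.\<close>

private lemma riemann_sum_Cauchy:
  assumes "p \<in> P" "0 < e"
  shows "\<exists>M. \<forall>j\<ge>M. \<forall>k\<ge>M. p (riemann_sum path (Suc j) - riemann_sum path (Suc k)) < e"
proof -
  have p: "seminorm_on V p" and tc: "translation_continuous p"
    using translation_continuous_P[OF assms(1)] by (auto simp: translation_continuous_def)
  obtain M where M: "0 < M"
    "\<And>n s t. M \<le> n \<Longrightarrow> s \<in> {0..1} \<Longrightarrow> t \<in> {0..1} \<Longrightarrow> \<bar>s - t\<bar> \<le> 1 / real n \<Longrightarrow> p (path s - path t) \<le> e / 3"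
    using path_uniformly_continuous[OF tc, of "e / 3"] \<open>0 < e\<close> by auto
  have fine: "p (riemann_sum path n - riemann_sum path (n * m)) \<le> e / 3" if "M \<le> n" "0 < m" for n m
    using that M by (intro seminorm_riemann_sum_refine[OF p subspace path_in]) auto
  have "p (riemann_sum path (Suc j) - riemann_sum path (Suc k)) < e" if "M \<le> j" "M \<le> k" for j k
  proof -
    have "p (riemann_sum path (Suc j) - riemann_sum path (Suc k))
        \<le> p (riemann_sum path (Suc j) - riemann_sum path (Suc j * Suc k))
          + p (riemann_sum path (Suc j * Suc k) - riemann_sum path (Suc k))"
      by (rule seminorm_on_diff_triangle[OF p subspace]) (rule riemann_sum_in)+
    also have "p (riemann_sum path (Suc j * Suc k) - riemann_sum path (Suc k)) =
        p (riemann_sum path (Suc k) - riemann_sum path (Suc k * Suc j))"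
      by (subst seminorm_on_diff_commute[OF p subspace riemann_sum_in riemann_sum_in]) (simp only: mult.commute)
    finally show ?thesis
      using fine[of "Suc j" "Suc k"] fine[of "Suc k" "Suc j"] that \<open>0 < e\<close> by linarith
  qed
  then show ?thesis by blast
qed

text \<open>On each subinterval the mean value theorem expresses the increment by
  \<open>path\<close> at an intermediate point, within 1/n of the left endpoint. The total error is
  thus at most the oscillation of \<open>path\<close> tested with \<phi>, and no integral has to be
  formed.\<close>

private lemma dist_app_riemann_sum:
  "(\<lambda>n. dist_app (riemann_sum path (Suc n)) \<phi>) \<longlonglongrightarrow>
    dist_app (translate x S) \<phi> - dist_app (translate (x + d) S) \<phi>"
proof (rule LIMSEQ_I)
  fix e :: real
  assume "0 < e"
  let ?F = "\<lambda>s. dist_app (translate (x + s *\<^sub>R d) S) \<phi>"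
  interpret D: continuous_operator V P "\<lambda>u. dist_app u \<phi>"
    by (rule continuous_operator_dist_app)
  obtain M where M: "0 < M"
    "\<And>n s t. M \<le> n \<Longrightarrow> s \<in> {0..1} \<Longrightarrow> t \<in> {0..1} \<Longrightarrow> \<bar>s - t\<bar> \<le> 1 / real n \<Longrightarrow>
      norm (dist_app (path s - path t) \<phi>) \<le> e / 2"
    using path_uniformly_continuous[OF D.translation_continuous_norm_L, of "e / 2"] \<open>0 < e\<close> by auto
  have bound: "norm (dist_app (riemann_sum path n) \<phi> - (?F 0 - ?F 1)) \<le> e / 2" if "M \<le> n" for n
  proof -
    have n: "0 < n" using that M(1) by simp
    have step: "norm (?F (real (Suc k) / n) - ?F (real k / n) + (1 / n) * dist_app (path (real k / n)) \<phi>) \<le> (1 / n) * (e / 2)"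
      if "k < n" for k
    proof -
      have lt: "real k / n < real (Suc k) / n"
        using n by (simp add: divide_strict_right_mono)
      have "\<exists>z>real k / n. z < real (Suc k) / n \<and> ?F (real (Suc k) / n) - ?F (real k / n) =
          (real (Suc k) / n - real k / n) * - dist_app (path z) \<phi>"
        by (rule MVT2[OF lt]) (rule DERIV_dist_app_translate)
      then obtain z where z: "real k / n < z" "z < real (Suc k) / n"
        "?F (real (Suc k) / n) - ?F (real k / n) = (1 / n) * - dist_app (path z) \<phi>"
        by (auto simp: diff_divide_distrib[symmetric])
      have "real (Suc k) / n \<le> 1" "0 \<le> real k / n" "real (Suc k) / n = real k / n + 1 / n"
        using \<open>k < n\<close> by (simp_all add: field_simps)
      with z(1,2) have "real k / n \<in> {0..1}" "z \<in> {0..1}" "\<bar>real k / n - z\<bar> \<le> 1 / n"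
        unfolding atLeastAtMost_iff by linarith+
      then have le: "norm (dist_app (path (real k / n) - path z) \<phi>) \<le> e / 2"
        by (rule M(2)[OF \<open>M \<le> n\<close>])
      have alg: "c * - a + c * b = c * (b - a)" for a b c :: real
        by (simp add: algebra_simps)
      have "?F (real (Suc k) / n) - ?F (real k / n) + (1 / n) * dist_app (path (real k / n)) \<phi> =
          (1 / n) * dist_app (path (real k / n) - path z) \<phi>"
        unfolding z(3) minus_distribution.rep_eq by (rule alg)
      then show ?thesis
        unfolding norm_mult using n le by (simp only: norm_mult) (intro mult_mono le, auto)
    qed
    have "(\<Sum>k<n. ?F (real (Suc k) / n) - ?F (real k / n)) = ?F 1 - ?F 0"
      using sum_lessThan_telescope[of "\<lambda>k. ?F (real k / real n)" n] n by simp
    moreover have "dist_app (riemann_sum path n) \<phi> = (\<Sum>k<n. (1 / n) * dist_app (path (real k / n)) \<phi>)"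
      by (simp only: riemann_sum_def scaleR_sum_right linear_sum[OF linear_dist_app_left] scaleR_distribution.rep_eq)
    ultimately have "dist_app (riemann_sum path n) \<phi> - (?F 0 - ?F 1) =
        (\<Sum>k<n. ?F (real (Suc k) / n) - ?F (real k / n) + (1 / n) * dist_app (path (real k / n)) \<phi>)"
      by (simp only: sum.distrib)
    also have "norm \<dots> \<le> (\<Sum>k<n. (1 / n) * (e / 2))"
      by (rule sum_norm_le) (use step in simp)
    also have "\<dots> = e / 2" using n by simp
    finally show ?thesis .
  qed
  show "\<exists>no. \<forall>n\<ge>no. norm (dist_app (riemann_sum path (Suc n)) \<phi> -
      (dist_app (translate x S) \<phi> - dist_app (translate (x + d) S) \<phi>)) < e"
  proof (intro exI[of _ M] allI impI)
    fix n
    assume "M \<le> n"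
    then have "norm (dist_app (riemann_sum path (Suc n)) \<phi> - (?F 0 - ?F 1)) \<le> e / 2"
      by (intro bound) simp
    also have "\<dots> < e" using \<open>0 < e\<close> by simp
    finally show "norm (dist_app (riemann_sum path (Suc n)) \<phi> -
        (dist_app (translate x S) \<phi> - dist_app (translate (x + d) S) \<phi>)) < e"
      by simp
  qed
qed

text \<open>The fundamental theorem of calculus along the segment from \<open>x\<close> to \<open>x + d\<close>. Completeness is
  what makes the Riemann sums converge in \<open>V\<close> and not only in the sense of distributions.\<close>

lemma riemann_sum_translate_tendsto:
  assumes "p \<in> P"
  shows "(\<lambda>n. p (riemann_sum (\<lambda>s. translate (x + s *\<^sub>R d) (divergence (vec_times d S))) (Suc n)
    - (translate x S - translate (x + d) S))) \<longlonglongrightarrow> 0"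
proof -
  have "sequentially_complete V P"
    using function_space by (simp add: function_space_def)
  then have "\<exists>v\<in>V. \<forall>p\<in>P. (\<lambda>n. p (riemann_sum path (Suc n) - v)) \<longlonglongrightarrow> 0"
    unfolding sequentially_complete_def
    by (elim allE[where x = "\<lambda>n. riemann_sum path (Suc n)"] impE)
      (auto intro: riemann_sum_in riemann_sum_Cauchy)
  then obtain v where v: "v \<in> V" "\<And>p. p \<in> P \<Longrightarrow> (\<lambda>n. p (riemann_sum path (Suc n) - v)) \<longlonglongrightarrow> 0"
    by blast
  \<comment> \<open>The limit in the seminorms is also a limit of distributions, and distributions
    are determined by their values on test functions.\<close>
  have "v = translate x S - translate (x + d) S"
  proof (rule distribution_eqI)
    fix \<phi>
    interpret D: continuous_operator V P "\<lambda>u. dist_app u \<phi>"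
      by (rule continuous_operator_dist_app)
    have "(\<lambda>n. dist_app (riemann_sum path (Suc n) - v) \<phi>) \<longlonglongrightarrow> 0"
      by (rule D.L_tendsto_0) (auto intro!: v subspace_diff[OF subspace] riemann_sum_in)
    then have "(\<lambda>n. dist_app (riemann_sum path (Suc n)) \<phi>) \<longlonglongrightarrow> dist_app v \<phi>"
      by (simp add: dist_app_simps LIM_zero_iff)
    from LIMSEQ_unique[OF this dist_app_riemann_sum]
    show "dist_app v \<phi> = dist_app (translate x S - translate (x + d) S) \<phi>"
      by (simp add: dist_app_simps)
  qed
  with v(2)[OF assms] show ?thesis by simp
qed

end

end

context continuous_operator
begin

text \<open>A mean value inequality: the increment is a limit of averages of the derivative along
  the segment, and every such average deviates from the derivative at x by at most the bound
  B.\<close>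

lemma translate_increment_bound:
  assumes "S \<in> V" "divergence (vec_times d S) \<in> V"
    and B: "\<And>s. s \<in> {0..1} \<Longrightarrow>
      norm (L (translate (x + s *\<^sub>R d) (divergence (vec_times d S)) - translate x (divergence (vec_times d S)))) \<le> B"
  shows "norm (L (translate (x + d) S) - L (translate x S) + L (translate x (divergence (vec_times d S)))) \<le> B"
proof -
  let ?D = "divergence (vec_times d S)"
  let ?f = "\<lambda>s. translate (x + s *\<^sub>R d) ?D"
  have f: "?f s \<in> V" "translate x ?D \<in> V" for s
    using assms(2) by (auto intro: translate_in)
  have R: "riemann_sum ?f n \<in> V" for n
    by (intro riemann_sum_in_subspace subspace f)
  have incr: "translate x S \<in> V" "translate (x + d) S \<in> V"
    using assms(1) by (auto intro: translate_in)
  have q: "seminorm_on V (\<lambda>u. norm (L u))"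
    using translation_continuous_norm_L by (simp add: translation_continuous_def)
  have "(\<lambda>n. L (riemann_sum ?f (Suc n) - (translate x S - translate (x + d) S))) \<longlonglongrightarrow> 0"
    by (rule L_tendsto_0)
      (auto intro!: riemann_sum_translate_tendsto assms subspace_diff[OF subspace] R incr)
  then have "(\<lambda>n. L (riemann_sum ?f (Suc n))) \<longlonglongrightarrow> L (translate x S) - L (translate (x + d) S)"
    by (simp add: L_diff R incr subspace_diff[OF subspace] LIM_zero_iff)
  then have "(\<lambda>n. L (riemann_sum ?f (Suc n)) - L (translate x ?D)) \<longlonglongrightarrow>
      L (translate x S) - L (translate (x + d) S) - L (translate x ?D)"
    by (intro tendsto_diff tendsto_const)
  moreover have "norm (L (riemann_sum ?f n) - L (translate x ?D)) \<le> B" if "0 < n" for n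
  proof -
    have "riemann_sum ?f n - translate x ?D = (1 / real n) *\<^sub>R (\<Sum>k<n. ?f (real k / real n) - translate x ?D)"
      using that by (simp add: riemann_sum_def sum_subtractf scaleR_diff_right sum_constant_scaleR)
    then have "norm (L (riemann_sum ?f n) - L (translate x ?D)) =
        (1 / real n) * norm (L (\<Sum>k<n. ?f (real k / real n) - translate x ?D))"
      using f by (simp add: L_diff[OF R f(2), symmetric] L_scale subspace_sum[OF subspace] subspace_diff[OF subspace])
    also have "\<dots> \<le> (1 / real n) * (\<Sum>k<n. norm (L (?f (real k / real n) - translate x ?D)))"
      using f by (intro mult_left_mono seminorm_on_sum[OF q subspace] subspace_diff[OF subspace]) auto
    also have "\<dots> \<le> (1 / real n) * (\<Sum>k<n. B)"
      by (intro mult_left_mono sum_mono B) auto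
    also have "\<dots> = B" using that by simp
    finally show ?thesis .
  qed
  ultimately have "norm (L (translate x S) - L (translate (x + d) S) - L (translate x ?D)) \<le> B"
    by (intro Lim_norm_ubound[OF trivial_limit_sequentially]) auto
  then show ?thesis
    using norm_minus_cancel[of "L (translate x S) - L (translate (x + d) S) - L (translate x ?D)"]
    by (simp add: algebra_simps)
qed

text \<open>The remainder on one segment is bounded by the oscillation of div (d S) under
  translation. Writing it through three partial derivatives of S, each oscillating by less than e/3
  with coefficients at most \<open>norm d\<close>, makes the bound uniform in the direction.\<close>

lemma has_derivative_translate:
  assumes S: "S \<in> V" and dS: "\<And>d. divergence (vec_times d S) \<in> V"
  shows "((\<lambda>a. L (translate a S)) has_derivative (\<lambda>d. - L (divergence (vec_times d (translate a S))))) (at a)"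
proof -
  let ?D = "\<lambda>b i. translate b (dist_partial i S)"
  \<comment> \<open>The choice d = e_i shows that every partial derivative of S lies in
    \<open>V\<close> separately.\<close>
  have part: "?D b i \<in> V" for b i
    using dS[of "axis i 1"]
    by (simp add: divergence_vec_times axis_def if_distrib[of "\<lambda>c. c *\<^sub>R _"] translate_in cong: if_cong)
  have expand: "translate b (divergence (vec_times d S)) = (\<Sum>i\<in>UNIV. d $ i *\<^sub>R ?D b i)" for b d
    by (simp add: divergence_vec_times linear_sum[OF linear_translate] linear_scale[OF linear_translate])
  have L_expand: "L (translate b (divergence (vec_times d S))) = (\<Sum>i\<in>UNIV. d $ i *\<^sub>R L (?D b i))" for b d
    unfolding expand by (simp add: L_sum part subspace_scale[OF subspace] L_scale)
  have "linear (\<lambda>d. - L (translate a (divergence (vec_times d S))))"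
    unfolding L_expand linear_iff
    by (simp add: scaleR_left_distrib sum.distrib scaleR_right.sum)
  then have bl: "bounded_linear (\<lambda>d. - L (translate a (divergence (vec_times d S))))"
    by (simp add: linear_conv_bounded_linear)
  have "\<exists>\<delta>>0. \<forall>b. norm (b - a) < \<delta> \<longrightarrow>
      norm (L (translate b S) - L (translate a S) - - L (translate a (divergence (vec_times (b - a) S)))) \<le> e * norm (b - a)"
    if "0 < e" for e
  proof -
    have "\<forall>\<^sub>F b in nhds a. \<forall>i. norm (L (?D b i - ?D a i)) < e / 3"
    proof (rule eventually_all_finite)
      fix i
      show "\<forall>\<^sub>F b in nhds a. norm (L (?D b i - ?D a i)) < e / 3"
        using \<open>0 < e\<close> part[of 0 i]
        by (intro order_tendstoD(2)[OF translation_continuous_nhds[OF translation_continuous_norm_L]]) auto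
    qed
    then obtain \<delta> where \<delta>: "0 < \<delta>" "\<And>b i. dist b a < \<delta> \<Longrightarrow> norm (L (?D b i - ?D a i)) < e / 3"
      unfolding eventually_nhds_metric by blast
    have "norm (L (translate b S) - L (translate a S) - - L (translate a (divergence (vec_times (b - a) S)))) \<le> e * norm (b - a)"
      if "norm (b - a) < \<delta>" for b
    proof -
      let ?d = "b - a"
      have "norm (L (translate (a + s *\<^sub>R ?d) (divergence (vec_times ?d S)) - translate a (divergence (vec_times ?d S)))) \<le> e * norm ?d"
        if "s \<in> {0..1}" for s
      proof -
        have "norm (s *\<^sub>R ?d) \<le> norm ?d"
          using that by (simp add: mult_left_le_one_le)
        then have "dist (a + s *\<^sub>R ?d) a < \<delta>"
          using \<open>norm ?d < \<delta>\<close> by (simp add: dist_norm)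
        note small = \<delta>(2)[OF this]
        have "L (translate (a + s *\<^sub>R ?d) (divergence (vec_times ?d S)) - translate a (divergence (vec_times ?d S))) =
            (\<Sum>i\<in>UNIV. ?d $ i *\<^sub>R L (?D (a + s *\<^sub>R ?d) i - ?D a i))"
          using dS by (simp add: L_diff translate_in L_expand part sum_subtractf scaleR_diff_right)
        also have "norm \<dots> \<le> (\<Sum>i\<in>(UNIV::3 set). norm ?d * (e / 3))"
        proof (rule sum_norm_le)
          fix i :: 3
          show "norm (?d $ i *\<^sub>R L (?D (a + s *\<^sub>R ?d) i - ?D a i)) \<le> norm ?d * (e / 3)"
            unfolding norm_scaleR
            using component_le_norm_cart[of ?d i] less_imp_le[OF small] by (intro mult_mono) auto
        qed
        also have "\<dots> = e * norm ?d" by simp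
        finally show ?thesis .
      qed
      from translate_increment_bound[OF S dS this] show ?thesis by simp
    qed
    with \<delta>(1) show ?thesis by blast
  qed
  with bl show ?thesis
    unfolding has_derivative_at_alt divergence_vec_times_translate by blast
qed

end

section \<open>The particle-field system\<close>

lemma linear_projection_sum:
  assumes L: "linear_projection restr W Wh L" and W: "subspace W" and G: "\<And>i. i \<in> A \<Longrightarrow> G i \<in> W"
  shows "L (\<Sum>i\<in>A. c i *\<^sub>R G i) = (\<Sum>i\<in>A. c i *\<^sub>R L (G i))"
  using G
proof (induction A rule: infinite_finite_induct)
  case (insert x A)
  then have "c x *\<^sub>R G x \<in> W" "(\<Sum>i\<in>A. c i *\<^sub>R G i) \<in> W"
    by (auto intro!: subspace_scale subspace_sum W)
  with insert L show ?case by (auto simp: linear_projection_def)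
next
  case (infinite A)
  have "L (0 *\<^sub>R 0) = 0 *\<^sub>R L 0"
    using L subspace_0[OF W] unfolding linear_projection_def by blast
  with infinite show ?case by simp
next
  case empty
  have "L (0 *\<^sub>R 0) = 0 *\<^sub>R L 0"
    using L subspace_0[OF W] unfolding linear_projection_def by blast
  then show ?case by simp
qed

lemma vec_times_expansion: "vec_times v T = (\<Sum>i\<in>UNIV. v $ i *\<^sub>R vec_times (axis i 1) T)"
  by (simp add: vec_times_def vec_eq_iff axis_def if_distrib[of "\<lambda>c. c *\<^sub>R _"] if_distrib[of "\<lambda>x. _ *\<^sub>R x"] cong: if_cong)

lemma vec_times_translate: "vec_times e (translate x T) = translate_vec x (vec_times e T)"
  by (simp add: vec_times_def translate_vec_def vec_eq_iff linear_scale[OF linear_translate])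

text \<open>Linearity of the projection in the constant vector turns the componentwise coupling into
  the projected current, so the electric force on a particle does the work that its current takes
  from the field.\<close>

lemma inner_coupling_field:
  assumes "linear_projection restr W Wh L" "subspace W" "\<And>e. vec_times e (translate x S) \<in> W"
  shows "v \<bullet> coupling_field L S F x = F \<bullet> L (vec_times v (translate x S))"
proof -
  have "F \<bullet> L (vec_times v (translate x S)) = F \<bullet> (\<Sum>i\<in>UNIV. v $ i *\<^sub>R L (vec_times (axis i 1) (translate x S)))"
    by (subst vec_times_expansion, subst linear_projection_sum[OF assms(1,2)]) (use assms(3) in auto)
  then show ?thesis
    by (simp add: coupling_field_def inner_sum_right inner_axis mult.commute)
qed

section \<open>The discrete complex and its weak curl\<close>

locale discrete_de_Rham =
  fixes \<Omega> :: "(real^3) set"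
    and Vh0 Vh3 :: "real L2 set" and Vh1 Vh2 :: "(real^3) L2 set"
  assumes open_\<Omega>: "open \<Omega>" and complex: "discrete_complex \<Omega> Vh0 Vh1 Vh2 Vh3"
begin

lemma discrete_spaces:
  "subspace Vh1" "finite_dimensional Vh1" "subspace Vh2" "finite_dimensional Vh2"
  using complex by (auto simp: discrete_complex_def discrete_space_def)

lemma grad_on_Vh0:
  assumes "u \<in> Vh0"
  shows "grad_on \<Omega> u \<in> Vh1" "has_grad_on \<Omega> u (grad_on \<Omega> u)"
  using complex assms grad_on_eq[OF open_\<Omega>] by (fastforce simp: discrete_complex_def)+

lemma curl_on_Vh1:
  assumes "F \<in> Vh1"
  shows "curl_on \<Omega> F \<in> Vh2" "has_curl_on \<Omega> F (curl_on \<Omega> F)"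
  using complex assms curl_on_eq[OF open_\<Omega>] by (fastforce simp: discrete_complex_def)+

lemma div_on_Vh2:
  assumes "F \<in> Vh2"
  shows "has_div_on \<Omega> F (div_on \<Omega> F)"
  using complex assms div_on_eq[OF open_\<Omega>] by (fastforce simp: discrete_complex_def)

lemma curl_on_grad_on: "u \<in> Vh0 \<Longrightarrow> curl_on \<Omega> (grad_on \<Omega> u) = 0"
  by (rule curl_on_eq[OF open_\<Omega> has_curl_on_grad[OF grad_on_Vh0(2)]])

lemma div_on_curl_on: "F \<in> Vh1 \<Longrightarrow> div_on \<Omega> (curl_on \<Omega> F) = 0"
  by (rule div_on_eq[OF open_\<Omega> has_div_on_curl[OF curl_on_Vh1(2)]])

text \<open>Riesz representation of the functional pairing \<open>F\<close> with the curl. Linearity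
  of this functional on \<open>Vh1\<close> comes from uniqueness of curls, as the sum of two curls
  is a curl of the sum.\<close>

lemma weak_curl:
  shows "weak_curl \<Omega> Vh1 F \<in> Vh1" "C \<in> Vh1 \<Longrightarrow> weak_curl \<Omega> Vh1 F \<bullet> C = F \<bullet> curl_on \<Omega> C"
proof -
  have "\<exists>!G. G \<in> Vh1 \<and> (\<forall>C\<in>Vh1. G \<bullet> C = F \<bullet> curl_on \<Omega> C)"
  proof (rule finite_dimensional_Riesz)
    show "F \<bullet> curl_on \<Omega> (C + D) = F \<bullet> curl_on \<Omega> C + F \<bullet> curl_on \<Omega> D" if "C \<in> Vh1" "D \<in> Vh1" for C D
      using curl_on_eq[OF open_\<Omega> has_curl_on_add[OF curl_on_Vh1(2) curl_on_Vh1(2)]] that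
      by (simp add: inner_add_right)
    show "F \<bullet> curl_on \<Omega> (c *\<^sub>R C) = c * (F \<bullet> curl_on \<Omega> C)" if "C \<in> Vh1" for c C
      using curl_on_eq[OF open_\<Omega> has_curl_on_scaleR[OF curl_on_Vh1(2)]] that by simp
  qed (rule discrete_spaces)+
  from theI'[OF this] show "weak_curl \<Omega> Vh1 F \<in> Vh1" "C \<in> Vh1 \<Longrightarrow> weak_curl \<Omega> Vh1 F \<bullet> C = F \<bullet> curl_on \<Omega> C"
    unfolding weak_curl_def by auto
qed

text \<open>Needed to differentiate the divergence of \<open>E t\<close> in time; the extension
  agrees with \<open>div_on\<close> at \<open>E t\<close> and at the terms of its derivative, which
  all lie in \<open>Vh2\<close>.\<close>

lemma div_on_bounded_linear_extension:
  obtains L where "bounded_linear L" "\<And>F. F \<in> Vh2 \<Longrightarrow> L F = div_on \<Omega> F"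
proof (rule subspace_bounded_linear_extension)
  show "div_on \<Omega> (F + G) = div_on \<Omega> F + div_on \<Omega> G" if "F \<in> Vh2" "G \<in> Vh2" for F G
    using div_on_eq[OF open_\<Omega> has_div_on_add] div_on_Vh2 that by simp
  show "div_on \<Omega> (c *\<^sub>R F) = c *\<^sub>R div_on \<Omega> F" if "F \<in> Vh2" for c F
    using div_on_eq[OF open_\<Omega> has_div_on_scaleR] div_on_Vh2 that by simp
qed (use discrete_spaces that in auto)

end

section \<open>Energy and charge balance along a solution\<close>

locale particle_field_system = discrete_de_Rham +
  fixes V0 V3 :: "distribution set" and V1 V2 :: "(distribution^3) set"
    and P :: "(distribution \<Rightarrow> real) set"
    and \<Pi>0 \<Pi>3 :: "distribution \<Rightarrow> real L2" and \<Pi>1 \<Pi>2 :: "distribution^3 \<Rightarrow> (real^3) L2"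
    and S :: distribution
    and N :: nat and m q :: "nat \<Rightarrow> real"
    and I :: "real set"
    and X V :: "nat \<Rightarrow> real \<Rightarrow> real^3"
    and E B :: "real \<Rightarrow> (real^3) L2"
  assumes domains: "translation_invariant_complex V0 V1 V2 V3"
    and \<Pi>1: "linear_projection (restricts_to_vec \<Omega>) V1 Vh1 \<Pi>1"
    and \<Pi>2: "linear_projection (restricts_to_vec \<Omega>) V2 Vh2 \<Pi>2"
    and \<Pi>3: "linear_projection (restricts_to \<Omega>) V3 Vh3 \<Pi>3"
    and commuting: "commuting_diagram \<Omega> V0 V1 V2 \<Pi>0 \<Pi>1 \<Pi>2 \<Pi>3"
    and V3: "function_space V3 P" and \<Pi>3_continuous: "seminorm_continuous V3 P \<Pi>3"
    and shape: "admissible_shape V0 V1 V2 V3 S"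
    and mass: "\<forall>p\<in>{1..N}. m p \<noteq> 0"
    and I: "is_interval I"
    and solution: "pic_solution \<Omega> Vh1 Vh2 \<Pi>1 \<Pi>2 S N m q I X V E B"
begin

lemma subspaces: "subspace V2" "subspace V3"
  using domains by (auto simp: translation_invariant_complex_def)

lemma shape_in: "vec_times e (translate x S) \<in> V2"
  using domains shape
  by (auto simp: translation_invariant_complex_def admissible_shape_def vec_times_translate image_subset_iff)

sublocale continuous_operator V3 P \<Pi>3
  using domains V3 \<Pi>3 \<Pi>3_continuous
  by unfold_locales (auto simp: translation_invariant_complex_def linear_projection_def image_subset_iff)

abbreviation current :: "real \<Rightarrow> (real^3) L2" where
  "current t \<equiv> (\<Sum>p=1..N. q p *\<^sub>R \<Pi>2 (vec_times (V p t) (translate (X p t) S)))"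

lemma fields_in: "t \<in> I \<Longrightarrow> E t \<in> Vh2" "t \<in> I \<Longrightarrow> B t \<in> Vh1"
  using solution by (auto simp: pic_solution_def)

lemma Ampere:
  assumes "t \<in> I"
  shows "(E has_vector_derivative curl_on \<Omega> (B t) - current t) (at t within I)"
proof -
  obtain dE where dE: "(E has_vector_derivative dE) (at t within I)" "- dE + curl_on \<Omega> (B t) = current t"
    using solution assms unfolding pic_solution_def by blast
  from dE(2) have "dE = curl_on \<Omega> (B t) - current t"
    by (simp add: algebra_simps flip: dE(2))
  with dE(1) show ?thesis by simp
qed

lemma Faraday:
  assumes "t \<in> I"
  shows "(B has_vector_derivative - weak_curl \<Omega> Vh1 (E t)) (at t within I)"
  using solution assms unfolding pic_solution_def by (metis add_eq_0_iff2)

lemma Newton: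
  assumes "t \<in> I" "p \<in> {1..N}"
  shows "(X p has_vector_derivative V p t) (at t within I)"
    and "(V p has_vector_derivative (q p / m p) *\<^sub>R (coupling_field \<Pi>2 S (E t) (X p t) +
      cross3 (V p t) (coupling_field \<Pi>1 S (B t) (X p t)))) (at t within I)"
  using solution assms unfolding pic_solution_def by auto

lemma constant_on_I:
  assumes "\<And>t. t \<in> I \<Longrightarrow> (f has_vector_derivative 0) (at t within I)" "s \<in> I" "t \<in> I"
  shows "f s = f t"
  using has_derivative_zero_unique[of I f s t] assms is_interval_convex[OF I]
  by (simp add: has_vector_derivative_def)

lemma kinetic_energy_derivative:
  assumes t: "t \<in> I" and p: "p \<in> {1..N}"
  shows "((\<lambda>t. m p / 2 * (norm (V p t))\<^sup>2) has_vector_derivative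
    q p * (E t \<bullet> \<Pi>2 (vec_times (V p t) (translate (X p t) S)))) (at t within I)"
proof -
  let ?dV = "(q p / m p) *\<^sub>R (coupling_field \<Pi>2 S (E t) (X p t) +
      cross3 (V p t) (coupling_field \<Pi>1 S (B t) (X p t)))"
  have "((\<lambda>t. m p / 2 * (V p t \<bullet> V p t)) has_vector_derivative m p / 2 * (V p t \<bullet> ?dV + ?dV \<bullet> V p t)) (at t within I)"
    by (intro has_vector_derivative_mult_right bounded_bilinear.has_vector_derivative[OF bounded_bilinear_inner]
        Newton(2) t p)
  \<comment> \<open>The mass cancels against the factor \<open>q p / m p\<close>, where it must be
    nonzero.\<close>
  moreover have "m p / 2 * (V p t \<bullet> ?dV + ?dV \<bullet> V p t) = q p * (V p t \<bullet> coupling_field \<Pi>2 S (E t) (X p t))"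
    using mass p by (simp add: inner_commute[of _ "V p t"] inner_add_right dot_cross_self)
  ultimately show ?thesis
    by (simp add: power2_norm_eq_inner inner_coupling_field[OF \<Pi>2 subspaces(1) shape_in])
qed

lemma energy_derivative:
  assumes t: "t \<in> I"
  shows "((\<lambda>t. discrete_hamiltonian N m (\<lambda>p. V p t) (E t) (B t)) has_vector_derivative 0) (at t within I)"
proof -
  let ?dE = "curl_on \<Omega> (B t) - current t" and ?dB = "- weak_curl \<Omega> Vh1 (E t)"
  have "((\<lambda>t. discrete_hamiltonian N m (\<lambda>p. V p t) (E t) (B t)) has_vector_derivative
      (\<Sum>p=1..N. q p * (E t \<bullet> \<Pi>2 (vec_times (V p t) (translate (X p t) S)))) +
      (E t \<bullet> ?dE + ?dE \<bullet> E t) / 2 + (B t \<bullet> ?dB + ?dB \<bullet> B t) / 2) (at t within I)"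
    unfolding discrete_hamiltonian_def
    by (intro has_vector_derivative_add has_vector_derivative_sum has_vector_derivative_divide
        kinetic_energy_derivative bounded_bilinear.has_vector_derivative[OF bounded_bilinear_inner]
        Ampere Faraday t)
  moreover have "(\<Sum>p=1..N. q p * (E t \<bullet> \<Pi>2 (vec_times (V p t) (translate (X p t) S)))) = E t \<bullet> current t"
    by (simp add: inner_sum_right)
  moreover have "weak_curl \<Omega> Vh1 (E t) \<bullet> B t = E t \<bullet> curl_on \<Omega> (B t)"
    by (intro weak_curl fields_in t)
  ultimately show ?thesis
    by (simp add: inner_diff_right inner_commute[of _ "E t"] inner_commute[of "B t"] diff_divide_distrib)
qed

lemma charge_derivative:
  assumes "t \<in> I" "p \<in> {1..N}"
  shows "((\<lambda>t. \<Pi>3 (translate (X p t) S)) has_vector_derivative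
    - div_on \<Omega> (\<Pi>2 (vec_times (V p t) (translate (X p t) S)))) (at t within I)"
proof -
  \<comment> \<open>The second fact holds because d S lies in \<open>V2\<close> for constant d, and
    the divergence maps \<open>V2\<close> into \<open>V3\<close>.\<close>
  have S: "S \<in> V3" "\<And>d. divergence (vec_times d S) \<in> V3"
    using shape domains by (auto simp: admissible_shape_def translation_invariant_complex_def)
  let ?D = "\<lambda>d. - \<Pi>3 (divergence (vec_times d (translate (X p t) S)))"
  have D: "((\<lambda>a. \<Pi>3 (translate a S)) has_derivative ?D) (at (X p t))"
    by (rule has_derivative_translate[OF S])
  then interpret D: bounded_linear ?D by (rule has_derivative_bounded_linear)
  have "((\<lambda>t. \<Pi>3 (translate (X p t) S)) has_derivative (\<lambda>h. ?D (h *\<^sub>R V p t))) (at t within I)"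
    by (rule has_derivative_compose[OF Newton(1)[OF assms, unfolded has_vector_derivative_def] D])
  then have "((\<lambda>t. \<Pi>3 (translate (X p t) S)) has_vector_derivative ?D (V p t)) (at t within I)"
    unfolding has_vector_derivative_def D.scaleR .
  then show ?thesis
    using commuting shape_in by (simp add: commuting_diagram_def)
qed

text \<open>The residual of the Gauss law is constant whether or not it vanishes initially. In its
  derivative div curl B is zero, and the divergence of each particle current cancels the change of
  that particle's projected charge.\<close>

lemma Gauss_law_preserved:
  assumes "s \<in> I" "t \<in> I"
  shows "div_on \<Omega> (E s) - \<Pi>3 (\<Sum>p=1..N. q p *\<^sub>R translate (X p s) S) =
    div_on \<Omega> (E t) - \<Pi>3 (\<Sum>p=1..N. q p *\<^sub>R translate (X p t) S)"
proof -
  obtain L where L: "bounded_linear L" "\<And>F. F \<in> Vh2 \<Longrightarrow> L F = div_on \<Omega> F"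
    by (rule div_on_bounded_linear_extension) blast
  interpret L: bounded_linear L by fact
  let ?j = "\<lambda>p t. \<Pi>2 (vec_times (V p t) (translate (X p t) S))"
  let ?g = "\<lambda>t. L (E t) - (\<Sum>p=1..N. q p *\<^sub>R \<Pi>3 (translate (X p t) S))"
  have "(?g has_vector_derivative 0) (at t within I)" if t: "t \<in> I" for t
  proof -
    have "(?g has_vector_derivative L (curl_on \<Omega> (B t) - current t) -
        (\<Sum>p=1..N. q p *\<^sub>R - div_on \<Omega> (?j p t))) (at t within I)"
      by (intro has_vector_derivative_diff has_vector_derivative_sum L.has_vector_derivative Ampere t
          bounded_linear.has_vector_derivative[OF bounded_linear_scaleR_right] charge_derivative)
    moreover have "?j p t \<in> Vh2" for p
      using \<Pi>2 shape_in by (simp add: linear_projection_def)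
    then have "L (curl_on \<Omega> (B t) - current t) = - (\<Sum>p=1..N. q p *\<^sub>R div_on \<Omega> (?j p t))"
      using fields_in(2)[OF t] by (simp add: L.diff L.sum L.scaleR L(2) curl_on_Vh1 div_on_curl_on)
    ultimately show ?thesis by (simp add: sum_negf)
  qed
  from constant_on_I[of ?g, OF this assms] have "?g s = ?g t" .
  moreover have "translate a S \<in> V3" for a
    using shape by (auto simp: admissible_shape_def intro: translate_in)
  ultimately show ?thesis
    using assms by (simp add: L(2) fields_in linear_projection_sum[OF \<Pi>3 subspaces(2)])
qed

text \<open>The field enters \<open>weak_div\<close> only through these pairings, so their constancy
  is shown in place of differentiating a described operator.\<close>

lemma magnetic_flux_preserved:
  assumes "\<psi> \<in> Vh0" "s \<in> I" "t \<in> I"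
  shows "B s \<bullet> grad_on \<Omega> \<psi> = B t \<bullet> grad_on \<Omega> \<psi>"
proof (rule constant_on_I[OF _ assms(2,3)])
  fix t
  assume "t \<in> I"
  have "((\<lambda>t. B t \<bullet> grad_on \<Omega> \<psi>) has_vector_derivative - weak_curl \<Omega> Vh1 (E t) \<bullet> grad_on \<Omega> \<psi>) (at t within I)"
    by (intro bounded_linear.has_vector_derivative[OF bounded_linear_inner_left] Faraday \<open>t \<in> I\<close>)
  then show "((\<lambda>t. B t \<bullet> grad_on \<Omega> \<psi>) has_vector_derivative 0) (at t within I)"
    using assms(1) by (simp add: weak_curl grad_on_Vh0 curl_on_grad_on)
qed

end

theorem theorem2:
  fixes \<Omega> :: "(real^3) set"
    and Vh0 Vh3 :: "real L2 set" and Vh1 Vh2 :: "(real^3) L2 set"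
    and V0 V3 :: "distribution set" and V1 V2 :: "(distribution^3) set"
    and P :: "(distribution \<Rightarrow> real) set"
    and \<Pi>0 \<Pi>3 :: "distribution \<Rightarrow> real L2" and \<Pi>1 \<Pi>2 :: "distribution^3 \<Rightarrow> (real^3) L2"
    and S :: distribution
    and N :: nat and m q :: "nat \<Rightarrow> real"
    and I :: "real set" and t0 :: real
    and X V :: "nat \<Rightarrow> real \<Rightarrow> real^3"
    and E B :: "real \<Rightarrow> (real^3) L2"
  assumes "open \<Omega>"
    and "discrete_complex \<Omega> Vh0 Vh1 Vh2 Vh3"
    and "translation_invariant_complex V0 V1 V2 V3"
    and "linear_projection (restricts_to \<Omega>) V0 Vh0 \<Pi>0"
    and "linear_projection (restricts_to_vec \<Omega>) V1 Vh1 \<Pi>1"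
    and "linear_projection (restricts_to_vec \<Omega>) V2 Vh2 \<Pi>2"
    and "linear_projection (restricts_to \<Omega>) V3 Vh3 \<Pi>3"
    and "commuting_diagram \<Omega> V0 V1 V2 \<Pi>0 \<Pi>1 \<Pi>2 \<Pi>3"
    and "function_space V3 P" and "seminorm_continuous V3 P \<Pi>3"
    and "admissible_shape V0 V1 V2 V3 S"
    and "\<forall>p\<in>{1..N}. m p \<noteq> 0"
    and "is_interval I" and "t0 \<in> I"
    and "pic_solution \<Omega> Vh1 Vh2 \<Pi>1 \<Pi>2 S N m q I X V E B"
  shows "(\<forall>t\<in>I. discrete_hamiltonian N m (\<lambda>p. V p t) (E t) (B t) =
            discrete_hamiltonian N m (\<lambda>p. V p t0) (E t0) (B t0)) \<and>
         (div_on \<Omega> (E t0) = \<Pi>3 (\<Sum>p=1..N. q p *\<^sub>R translate (X p t0) S) \<longrightarrow>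
           (\<forall>t\<in>I. div_on \<Omega> (E t) = \<Pi>3 (\<Sum>p=1..N. q p *\<^sub>R translate (X p t) S))) \<and>
         (weak_div \<Omega> Vh0 (B t0) = 0 \<longrightarrow> (\<forall>t\<in>I. weak_div \<Omega> Vh0 (B t) = 0))"
proof -
  interpret particle_field_system \<Omega> Vh0 Vh3 Vh1 Vh2 V0 V3 V1 V2 P \<Pi>0 \<Pi>3 \<Pi>1 \<Pi>2 S N m q I X V E B
    using assms by unfold_locales
  show ?thesis
  proof (intro conjI ballI impI)
    fix t
    assume t: "t \<in> I"
    show "discrete_hamiltonian N m (\<lambda>p. V p t) (E t) (B t) =
        discrete_hamiltonian N m (\<lambda>p. V p t0) (E t0) (B t0)"
      using constant_on_I[OF energy_derivative t \<open>t0 \<in> I\<close>] .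
    show "div_on \<Omega> (E t) = \<Pi>3 (\<Sum>p=1..N. q p *\<^sub>R translate (X p t) S)"
      if "div_on \<Omega> (E t0) = \<Pi>3 (\<Sum>p=1..N. q p *\<^sub>R translate (X p t0) S)"
      using Gauss_law_preserved[OF t \<open>t0 \<in> I\<close>] that by simp
    \<comment> \<open>For \<open>B t\<close> and \<open>B t0\<close> the defining conditions
      coincide, hence so do the described values.\<close>
    show "weak_div \<Omega> Vh0 (B t) = 0" if "weak_div \<Omega> Vh0 (B t0) = 0"
      using magnetic_flux_preserved[OF _ t \<open>t0 \<in> I\<close>] that
      by (simp add: weak_div_def cong: conj_cong)
  qed
qed

end
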